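(* Let $f\in L^2(\mathbb{R})$ be complex-valued, let $$F(\lambda)=\int_{\mathbb{R}}\overline{f(x)}\,f(\lambda x)\,dx,\qquad \lambda\in\mathbb{R}^\times,$$ and let $c_0\ge 0$ be a constant. Then $$F(\lambda)=c_0(1+\lambda^2)^{-1/2}\qquad\text{for all }\lambda\in\mathbb{R}^\times$$ if and only if $f$ is even (i.e., $f(-x)=f(x)$ for almost every $x\in\mathbb{R}$) and $$|\mathbf{M}_0[f](\tau)|=\frac{\sqrt{c_0}}{\pi^{1/4}}\,\bigl|\Gamma\bigl(\tfrac14+\tfrac{i}{2}\tau\bigr)\bigr|\qquad\text{for almost every }\tau\in\mathbb{R}.$$
   Context: $\mathbb{R}^\times=\mathbb{R}\setminus\{0\}$, and $\Gamma$ is the Euler Gamma function. The Mellin transform $\mathbf{M}_0$ is $$\mathbf{M}_0[f](\tau)=\int_{\mathbb{R}^\times}|x|^{-\frac12+i\tau}f(x)\,dx,\qquad \tau\in\mathbb{R}.$$ For general $f\in L^2(\mathbb{R})$ it is understood in the $L^2$ (Plancherel) sense, just as for the Fourier transform: $\mathbf{M}_0$ is the continuous extension to $L^2(\mathbb{R})\to L^2(\mathbb{R})$ of the map given by the integral on $L^2$ functions compactly supported in $\mathbb{R}^\times$; so $\mathbf{M}_0[f]$ is defined almost everywhere on $\mathbb{R}$. *)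

theory Defs
  imports "HOL-Analysis.Analysis"
begin

text \<open>
  Elements of L^2(R) are represented by functions rather than by classes modulo equality almost
  everywhere; accordingly the functional \<open>L2dist\<close> is only a pseudometric.
\<close>

definition L2 :: "(real \<Rightarrow> complex) set" where
  "L2 = {f. f \<in> borel_measurable lebesgue \<and> integrable lebesgue (\<lambda>x. (cmod (f x))\<^sup>2)}"

definition L2dist :: "(real \<Rightarrow> complex) \<Rightarrow> (real \<Rightarrow> complex) \<Rightarrow> real" where
  "L2dist f g = sqrt (LINT x|lebesgue. (cmod (f x - g x))\<^sup>2)"

definition compactly_supported_off_0 :: "(real \<Rightarrow> complex) \<Rightarrow> bool" where
  "compactly_supported_off_0 f \<longleftrightarrow>
     (\<exists>K. compact K \<and> K \<subseteq> - {0} \<and> (AE x in lebesgue. x \<notin> K \<longrightarrow> f x = 0))"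

definition mellin_integral :: "(real \<Rightarrow> complex) \<Rightarrow> real \<Rightarrow> complex" where
  "mellin_integral f \<tau> =
     (LINT x:(- {0})|lebesgue. complex_of_real \<bar>x\<bar> powr (- 1 / 2 + \<i> * complex_of_real \<tau>) * f x)"

definition is_mellin_extension :: "((real \<Rightarrow> complex) \<Rightarrow> (real \<Rightarrow> complex)) \<Rightarrow> bool" where
  "is_mellin_extension T \<longleftrightarrow>
     (\<forall>f\<in>L2. T f \<in> L2) \<and>
     (\<forall>f\<in>L2. compactly_supported_off_0 f \<longrightarrow>
        (AE \<tau> in lebesgue. T f \<tau> = mellin_integral f \<tau>)) \<and>
     (\<forall>f\<in>L2. \<forall>\<epsilon>>0. \<exists>\<delta>>0. \<forall>g\<in>L2. L2dist f g < \<delta> \<longrightarrow> L2dist (T f) (T g) < \<epsilon>)"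

text \<open>
  Such an extension exists by Plancherel's theorem. By density of the functions compactly supported
  off 0, its value at each element of \<open>L2\<close> is unique up to equality almost everywhere, so the
  choice below only fixes representatives.
\<close>

definition M0 :: "(real \<Rightarrow> complex) \<Rightarrow> (real \<Rightarrow> complex)" where
  "M0 = (SOME T. is_mellin_extension T)"

definition dilation_correlation :: "(real \<Rightarrow> complex) \<Rightarrow> real \<Rightarrow> complex" where
  "dilation_correlation f a = (LINT x|lebesgue. cnj (f x) * f (a * x))"

end

(*
  In the variable t = ln |x| the Mellin transform of f is the Fourier transform of
  g(t) = exp(t/2) (f(exp t) + f(-exp t)), and the dilation correlation F of f becomes the
  autocorrelation exp(s/2) (F(exp s) + F(-exp s)) of g.  Hence, by Plancherel, this autocorrelation
  is the Fourier transform of |M0 f|^2 up to a constant.  The Gaussian f(x) = exp(-x^2) has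
  F(a) = sqrt pi (1 + a^2)^(-1/2) and M0 f(tau) = Gamma(1/4 + i tau/2), so the theorem compares f
  with a multiple of the Gaussian: uniqueness of Fourier transforms gives |M0 f| from F, and
  Plancherel gives F back.  Evenness is forced by F(1) = F(-1), the equality case of
  Cauchy-Schwarz for f and its reflection.
*)

theory Submission
  imports Defs "HOL-Probability.Probability"
begin

text \<open>For a general f in L2 the Mellin integral need not converge absolutely, and
  \<open>M0\<close> is an arbitrary choice among the continuous extensions, so nothing can be
  computed from it directly. Identities are proved for bounded functions supported in some annulus 1
  / N \<le> \<bar>x\<bar> \<le> N and carried to L2 by truncation; \<open>mellin_L2\<close> records
  the limit and \<open>mellin_extension_eq\<close> identifies it with \<open>M0\<close>. Plancherel
  comes from Fourier inversion of an autocorrelation, which is bounded, continuous and integrable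
  and has a nonnegative transform. A nonnegative transform of a bounded integrable function is
  itself integrable, so inversion applies. The autocorrelation sees only the sum of F at exp s and
  at - exp s. For even functions the two values agree and can be recovered, which is why evenness
  stands beside the modulus condition: the transform annihilates odd functions. The constant arises
  from the factor sqrt pi in the Gaussian's correlation: f is compared with the Gaussian times the
  square root of c0 / sqrt pi, which is sqrt c0 / pi^(1/4).\<close>

section \<open>Square-integrable functions\<close>

lemma norm_integral_le_integral:
  fixes f :: "'a \<Rightarrow> 'b::{banach, second_countable_topology}"
  assumes "integrable M f" "integrable M g" "\<And>x. x \<in> space M \<Longrightarrow> norm (f x) \<le> g x"
  shows "norm (integral\<^sup>L M f) \<le> integral\<^sup>L M g"
  using integral_norm_bound[of M f] integral_mono[OF integrable_norm[OF assms(1)] assms(2,3)]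
  by linarith

lemma norm_diff_power2_le:
  fixes a b :: complex
  shows "(cmod (a - b))\<^sup>2 \<le> 2 * (cmod a)\<^sup>2 + 2 * (cmod b)\<^sup>2"
proof -
  have "(cmod (a - b))\<^sup>2 \<le> (cmod a + cmod b)\<^sup>2"
    by (intro power_mono norm_triangle_ineq4) auto
  also have "\<dots> \<le> 2 * (cmod a)\<^sup>2 + 2 * (cmod b)\<^sup>2"
    using sum_squares_bound[of "cmod a" "cmod b"] by (simp add: power2_sum)
  finally show ?thesis .
qed

lemma integrable_mult_L2:
  fixes f g :: "'a \<Rightarrow> complex"
  assumes [measurable]: "f \<in> borel_measurable M" "g \<in> borel_measurable M"
    and f: "integrable M (\<lambda>x. (cmod (f x))\<^sup>2)" and g: "integrable M (\<lambda>x. (cmod (g x))\<^sup>2)"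
  shows "integrable M (\<lambda>x. f x * g x)"
proof (rule Bochner_Integration.integrable_bound)
  show "integrable M (\<lambda>x. (cmod (f x))\<^sup>2 + (cmod (g x))\<^sup>2)"
    using f g by simp
  show "AE x in M. cmod (f x * g x) \<le> norm ((cmod (f x))\<^sup>2 + (cmod (g x))\<^sup>2)"
  proof (rule AE_I2)
    fix x
    have "cmod (f x) * cmod (g x) \<le> 2 * cmod (f x) * cmod (g x)" by simp
    also have "\<dots> \<le> (cmod (f x))\<^sup>2 + (cmod (g x))\<^sup>2" by (rule sum_squares_bound)
    finally show "cmod (f x * g x) \<le> norm ((cmod (f x))\<^sup>2 + (cmod (g x))\<^sup>2)"
      by (simp add: norm_mult)
  qed
qed simp

lemma integrable_diff_L2:
  fixes f g :: "'a \<Rightarrow> complex"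
  assumes [measurable]: "f \<in> borel_measurable M" "g \<in> borel_measurable M"
    and f: "integrable M (\<lambda>x. (cmod (f x))\<^sup>2)" and g: "integrable M (\<lambda>x. (cmod (g x))\<^sup>2)"
  shows "integrable M (\<lambda>x. (cmod (f x - g x))\<^sup>2)"
proof (rule Bochner_Integration.integrable_bound)
  show "integrable M (\<lambda>x. 2 * (cmod (f x))\<^sup>2 + 2 * (cmod (g x))\<^sup>2)"
    using f g by simp
qed (use norm_diff_power2_le in \<open>auto intro!: AE_I2 order.trans[OF _ abs_ge_self]\<close>)

text \<open>Distances are kept squared throughout, so Minkowski's inequality is replaced by (a +
  b)^2 \<le> 2 a^2 + 2 b^2. The generous constants of the later estimates accumulate from these
  factors 2.\<close>

lemma L2_triangle:
  fixes f g h :: "'a \<Rightarrow> complex"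
  assumes [measurable]: "f \<in> borel_measurable M" "g \<in> borel_measurable M" "h \<in> borel_measurable M"
    and f: "integrable M (\<lambda>x. (cmod (f x))\<^sup>2)" and g: "integrable M (\<lambda>x. (cmod (g x))\<^sup>2)"
    and h: "integrable M (\<lambda>x. (cmod (h x))\<^sup>2)"
  shows "(LINT x|M. (cmod (f x - h x))\<^sup>2) \<le>
    2 * (LINT x|M. (cmod (f x - g x))\<^sup>2) + 2 * (LINT x|M. (cmod (g x - h x))\<^sup>2)"
proof -
  have "(LINT x|M. (cmod (f x - h x))\<^sup>2) \<le>
     (LINT x|M. 2 * (cmod (f x - g x))\<^sup>2 + 2 * (cmod (g x - h x))\<^sup>2)"
  proof (rule integral_mono)
    show "(cmod (f x - h x))\<^sup>2 \<le> 2 * (cmod (f x - g x))\<^sup>2 + 2 * (cmod (g x - h x))\<^sup>2" for x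
      using norm_diff_power2_le[of "f x - g x" "h x - g x"] by (simp add: norm_minus_commute)
  qed (intro integrable_diff_L2 Bochner_Integration.integrable_add integrable_mult_right assms)+
  also have "\<dots> = 2 * (LINT x|M. (cmod (f x - g x))\<^sup>2) + 2 * (LINT x|M. (cmod (g x - h x))\<^sup>2)"
    by (subst Bochner_Integration.integral_add)
       (auto intro!: integrable_diff_L2 integrable_mult_right assms)
  finally show ?thesis .
qed

lemma Cauchy_Schwarz_L2:
  fixes f g :: "'a \<Rightarrow> complex"
  assumes [measurable]: "f \<in> borel_measurable M" "g \<in> borel_measurable M"
    and f: "integrable M (\<lambda>x. (cmod (f x))\<^sup>2)" and g: "integrable M (\<lambda>x. (cmod (g x))\<^sup>2)"
  shows "(LINT x|M. cmod (f x) * cmod (g x)) \<le>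
    sqrt (LINT x|M. (cmod (f x))\<^sup>2) * sqrt (LINT x|M. (cmod (g x))\<^sup>2)"
proof -
  define P where "P = (LINT x|M. (cmod (f x))\<^sup>2)"
  define Q where "Q = (LINT x|M. (cmod (g x))\<^sup>2)"
  define R where "R = (LINT x|M. cmod (f x) * cmod (g x))"
  have i: "integrable M (\<lambda>x. cmod (f x) * cmod (g x))"
    using integrable_norm[OF integrable_mult_L2[OF assms]] by (simp add: norm_mult)
  \<comment> \<open>The quadratic form is kept homogeneous in t and s, so that the degenerate case Q
    = 0 can be read off from it too.\<close>
  have quad: "0 \<le> t\<^sup>2 * P - 2 * t * s * R + s\<^sup>2 * Q" for t s :: real
  proof -
    have "0 \<le> (LINT x|M. (t * cmod (f x) - s * cmod (g x))\<^sup>2)" by simp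
    also have "\<dots> = (LINT x|M. t\<^sup>2 * (cmod (f x))\<^sup>2 - 2 * t * s * (cmod (f x) * cmod (g x))
                      + s\<^sup>2 * (cmod (g x))\<^sup>2)"
      by (simp add: power2_diff power_mult_distrib algebra_simps)
    also have "\<dots> = t\<^sup>2 * P - 2 * t * s * R + s\<^sup>2 * Q"
      unfolding P_def Q_def R_def using i f g by simp
    finally show ?thesis .
  qed
  have "P \<ge> 0" "Q \<ge> 0" by (simp_all add: P_def Q_def)
  have "R\<^sup>2 \<le> P * Q"
  proof (cases "Q = 0")
    case True
    have "R \<le> 0"
    proof (rule ccontr)
      assume "\<not> R \<le> 0"
      then show False
        \<comment> \<open>With t = 1 and Q = 0 the form is P - 2 s R, and this s makes it equal to
          -1.\<close>
        using quad[of 1 "(P + 1) / (2 * R)"] True by simp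
    qed
    moreover have "R \<ge> 0" by (simp add: R_def)
    ultimately show ?thesis using True by simp
  next
    case False
    \<comment> \<open>t = Q, s = R is the minimising direction s / t = R / Q, cleared of its
      denominator.\<close>
    have "0 \<le> Q\<^sup>2 * P - 2 * Q * R * R + R\<^sup>2 * Q" by (rule quad)
    also have "\<dots> = Q * (P * Q - R\<^sup>2)" by (simp add: power2_eq_square algebra_simps)
    finally show ?thesis using False \<open>Q \<ge> 0\<close> by (simp add: zero_le_mult_iff)
  qed
  then have "R \<le> sqrt (P * Q)" by (rule real_le_rsqrt)
  then show ?thesis by (simp add: P_def Q_def R_def real_sqrt_mult)
qed

text \<open>With a character for \<open>e\<close>, this moves Plancherel's identity from truncations
  to their L2 limit. The difference of squared moduli is at most \<bar>a - b\<bar>^2 + 2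
  \<bar>b\<bar> \<bar>a - b\<bar>, and Cauchy-Schwarz controls the mixed term.\<close>

lemma L2_tendsto_imp_tendsto_integral_norm_power2:
  fixes h :: "'a \<Rightarrow> complex" and k :: "nat \<Rightarrow> 'a \<Rightarrow> complex" and e :: "'a \<Rightarrow> complex"
  assumes [measurable]: "\<And>n. k n \<in> borel_measurable M" "h \<in> borel_measurable M"
      "e \<in> borel_measurable M"
    and k: "\<And>n. integrable M (\<lambda>x. (cmod (k n x))\<^sup>2)" and h: "integrable M (\<lambda>x. (cmod (h x))\<^sup>2)"
    and e: "\<And>x. cmod (e x) \<le> 1"
    and lim: "(\<lambda>n. LINT x|M. (cmod (k n x - h x))\<^sup>2) \<longlonglongrightarrow> 0"
  shows "(\<lambda>n. LINT x|M. of_real ((cmod (k n x))\<^sup>2) * e x) \<longlonglongrightarrow>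
    (LINT x|M. of_real ((cmod (h x))\<^sup>2) * e x)"
proof -
  define d where "d n = (LINT x|M. (cmod (k n x - h x))\<^sup>2)" for n
  have mult_e: "integrable M (\<lambda>x. of_real (p x) * e x)"
    if "integrable M p" for p :: "'a \<Rightarrow> real"
  proof (rule Bochner_Integration.integrable_bound[OF that])
    show "(\<lambda>x. of_real (p x) * e x) \<in> borel_measurable M"
      using that by measurable
    show "AE x in M. cmod (of_real (p x) * e x) \<le> norm (p x)"
      using e by (auto simp: norm_mult mult_left_le)
  qed
  have di: "integrable M (\<lambda>x. (cmod (k n x - h x))\<^sup>2)" for n
    by (intro integrable_diff_L2 k h) auto
  have ci: "integrable M (\<lambda>x. cmod (h x) * cmod (k n x - h x))" for n
  proof -
    have "integrable M (\<lambda>x. h x * (k n x - h x))"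
      by (intro integrable_mult_L2 h di) auto
    from integrable_norm[OF this] show ?thesis by (simp add: norm_mult)
  qed
  have pt: "\<bar>(cmod a)\<^sup>2 - (cmod b)\<^sup>2\<bar> \<le> (cmod (a - b))\<^sup>2 + 2 * (cmod b * cmod (a - b))"
    for a b :: complex
  proof -
    have "\<bar>(cmod a)\<^sup>2 - (cmod b)\<^sup>2\<bar> = \<bar>cmod a - cmod b\<bar> * (cmod a + cmod b)"
    proof -
      have "(cmod a)\<^sup>2 - (cmod b)\<^sup>2 = (cmod a - cmod b) * (cmod a + cmod b)"
        by (simp add: power2_eq_square algebra_simps)
      then show ?thesis by (simp add: abs_mult)
    qed
    also have "\<dots> \<le> cmod (a - b) * (cmod (a - b) + 2 * cmod b)"
      using norm_triangle_ineq3[of a b] norm_triangle_ineq2[of a b]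
      by (intro mult_mono) auto
    finally show ?thesis by (simp add: power2_eq_square algebra_simps)
  qed
  have bound: "cmod ((LINT x|M. of_real ((cmod (k n x))\<^sup>2) * e x) - (LINT x|M. of_real ((cmod (h x))\<^sup>2) * e x))
      \<le> d n + 2 * (sqrt (LINT x|M. (cmod (h x))\<^sup>2) * sqrt (d n))" for n
  proof -
    have "(LINT x|M. of_real ((cmod (k n x))\<^sup>2) * e x) - (LINT x|M. of_real ((cmod (h x))\<^sup>2) * e x)
        = (LINT x|M. of_real ((cmod (k n x))\<^sup>2) * e x - of_real ((cmod (h x))\<^sup>2) * e x)"
      by (intro Bochner_Integration.integral_diff[symmetric] mult_e k h)
    also have "cmod \<dots> \<le> (LINT x|M. (cmod (k n x - h x))\<^sup>2 + 2 * (cmod (h x) * cmod (k n x - h x)))"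
    proof (rule norm_integral_le_integral)
      show "integrable M (\<lambda>x. of_real ((cmod (k n x))\<^sup>2) * e x - of_real ((cmod (h x))\<^sup>2) * e x)"
        by (intro Bochner_Integration.integrable_diff mult_e k h)
      show "integrable M (\<lambda>x. (cmod (k n x - h x))\<^sup>2 + 2 * (cmod (h x) * cmod (k n x - h x)))"
        using di ci by simp
      fix x
      have "cmod (of_real ((cmod (k n x))\<^sup>2) * e x - of_real ((cmod (h x))\<^sup>2) * e x)
          = \<bar>(cmod (k n x))\<^sup>2 - (cmod (h x))\<^sup>2\<bar> * cmod (e x)"
        by (simp only: norm_mult norm_of_real flip: left_diff_distrib of_real_diff)
      also have "\<dots> \<le> \<bar>(cmod (k n x))\<^sup>2 - (cmod (h x))\<^sup>2\<bar>"
        using e by (simp add: mult_left_le)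
      also note pt
      finally show "cmod (of_real ((cmod (k n x))\<^sup>2) * e x - of_real ((cmod (h x))\<^sup>2) * e x)
        \<le> (cmod (k n x - h x))\<^sup>2 + 2 * (cmod (h x) * cmod (k n x - h x))" .
    qed
    also have "\<dots> = d n + 2 * (LINT x|M. cmod (h x) * cmod (k n x - h x))"
      using di ci by (simp add: d_def)
    also have "\<dots> \<le> d n + 2 * (sqrt (LINT x|M. (cmod (h x))\<^sup>2) * sqrt (d n))"
      using Cauchy_Schwarz_L2[OF _ _ h di[of n]] by (simp add: d_def)
    finally show ?thesis .
  qed
  have d0: "d \<longlonglongrightarrow> 0" unfolding d_def by (rule lim)
  have "(\<lambda>n. d n + 2 * (sqrt (LINT x|M. (cmod (h x))\<^sup>2) * sqrt (d n))) \<longlonglongrightarrow>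
      0 + 2 * (sqrt (LINT x|M. (cmod (h x))\<^sup>2) * sqrt 0)"
    by (intro tendsto_add tendsto_mult tendsto_real_sqrt tendsto_const d0)
  then have "(\<lambda>n. d n + 2 * (sqrt (LINT x|M. (cmod (h x))\<^sup>2) * sqrt (d n))) \<longlonglongrightarrow> 0"
    by simp
  then have "(\<lambda>n. (LINT x|M. of_real ((cmod (k n x))\<^sup>2) * e x) - (LINT x|M. of_real ((cmod (h x))\<^sup>2) * e x)) \<longlonglongrightarrow> 0"
    by (rule Lim_null_comparison[OF always_eventually, rotated]) (use bound in blast)
  then show ?thesis by (rule LIM_zero_cancel)
qed

text \<open>The fixed function \<open>g\<close> has two uses: as a member of a Cauchy sequence it
  gives the distance to the pointwise limit, and as an L2 limit it shows that the two limits agree.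
  An eventual bound suffices because the limes inferior ignores finitely many terms.\<close>

lemma L2_Fatou:
  fixes h g :: "'a \<Rightarrow> complex" and k :: "nat \<Rightarrow> 'a \<Rightarrow> complex"
  assumes [measurable]: "\<And>n. k n \<in> borel_measurable M" "h \<in> borel_measurable M"
      "g \<in> borel_measurable M"
    and int: "\<And>n. integrable M (\<lambda>x. (cmod (k n x - g x))\<^sup>2)"
    and bound: "eventually (\<lambda>n. (LINT x|M. (cmod (k n x - g x))\<^sup>2) \<le> B) sequentially"
    and lim: "AE x in M. (\<lambda>n. k n x) \<longlonglongrightarrow> h x"
  shows "integrable M (\<lambda>x. (cmod (h x - g x))\<^sup>2)" "(LINT x|M. (cmod (h x - g x))\<^sup>2) \<le> B"
proof -
  obtain n where "(LINT x|M. (cmod (k n x - g x))\<^sup>2) \<le> B"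
    using eventually_happens'[OF sequentially_bot bound] by blast
  moreover have "0 \<le> (LINT x|M. (cmod (k n x - g x))\<^sup>2)" by simp
  ultimately have B: "0 \<le> B" by linarith
  have "(\<integral>\<^sup>+x. ennreal ((cmod (h x - g x))\<^sup>2) \<partial>M)
      = (\<integral>\<^sup>+x. liminf (\<lambda>n. ennreal ((cmod (k n x - g x))\<^sup>2)) \<partial>M)"
  proof (rule nn_integral_cong_AE, use lim in eventually_elim)
    fix x assume "(\<lambda>n. k n x) \<longlonglongrightarrow> h x"
    then have "(\<lambda>n. ennreal ((cmod (k n x - g x))\<^sup>2)) \<longlonglongrightarrow> ennreal ((cmod (h x - g x))\<^sup>2)"
      by (intro tendsto_intros tendsto_ennrealI)
    then show "ennreal ((cmod (h x - g x))\<^sup>2) = liminf (\<lambda>n. ennreal ((cmod (k n x - g x))\<^sup>2))"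
      by (intro lim_imp_Liminf[symmetric]) auto
  qed
  also have "\<dots> \<le> liminf (\<lambda>n. \<integral>\<^sup>+x. ennreal ((cmod (k n x - g x))\<^sup>2) \<partial>M)"
    by (intro nn_integral_liminf) measurable
  also have "\<dots> = liminf (\<lambda>n. ennreal (LINT x|M. (cmod (k n x - g x))\<^sup>2))"
    by (simp add: nn_integral_eq_integral int)
  also have "\<dots> \<le> liminf (\<lambda>n. ennreal B)"
    by (intro Liminf_mono eventually_mono[OF bound]) (simp add: ennreal_leI)
  also have "\<dots> = ennreal B" by (simp add: Liminf_const)
  finally have *: "(\<integral>\<^sup>+x. ennreal ((cmod (h x - g x))\<^sup>2) \<partial>M) \<le> ennreal B" .
  show I: "integrable M (\<lambda>x. (cmod (h x - g x))\<^sup>2)"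
    using * by (intro integrableI_bounded) (auto simp: top_unique less_top[symmetric])
  show "(LINT x|M. (cmod (h x - g x))\<^sup>2) \<le> B"
    using * B by (simp add: nn_integral_eq_integral[OF I])
qed

lemma L2_tendsto_AE_unique:
  fixes h g :: "'a \<Rightarrow> complex" and k :: "nat \<Rightarrow> 'a \<Rightarrow> complex"
  assumes [measurable]: "\<And>n. k n \<in> borel_measurable M" "h \<in> borel_measurable M"
      "g \<in> borel_measurable M"
    and int: "\<And>n. integrable M (\<lambda>x. (cmod (k n x - g x))\<^sup>2)"
    and lim: "(\<lambda>n. LINT x|M. (cmod (k n x - g x))\<^sup>2) \<longlonglongrightarrow> 0"
    and pt: "AE x in M. (\<lambda>n. k n x) \<longlonglongrightarrow> h x"
  shows "AE x in M. h x = g x"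
proof -
  have ev: "eventually (\<lambda>n. (LINT x|M. (cmod (k n x - g x))\<^sup>2) \<le> B) sequentially" if "B > 0" for B
    using order_tendstoD(2)[OF lim that] by (rule eventually_mono) simp
  have "(LINT x|M. (cmod (h x - g x))\<^sup>2) \<le> 0"
    by (rule field_le_epsilon) (use L2_Fatou(2)[OF _ _ _ int ev pt] in auto)
  moreover have "integrable M (\<lambda>x. (cmod (h x - g x))\<^sup>2)"
    by (rule L2_Fatou(1)[OF _ _ _ int ev[of 1] pt]) auto
  ultimately have "AE x in M. (cmod (h x - g x))\<^sup>2 = 0"
    by (subst integral_nonneg_eq_0_iff_AE[symmetric]) (auto intro: antisym)
  then show ?thesis by eventually_elim simp
qed

text \<open>A subsequence that is Cauchy almost everywhere supplies the candidate limit; Fatou's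
  lemma then compares it with every late member of the full sequence. Sigma-finiteness enters
  through the strictly positive weight \<open>w\<close>.\<close>

theorem Riesz_Fischer_L2:
  fixes k :: "nat \<Rightarrow> 'a \<Rightarrow> complex"
  assumes "sigma_finite_measure M"
    and [measurable]: "\<And>n. k n \<in> borel_measurable M"
    and k: "\<And>n. integrable M (\<lambda>x. (cmod (k n x))\<^sup>2)"
    and Cauchy: "\<And>e. e > 0 \<Longrightarrow> \<exists>N. \<forall>i\<ge>N. \<forall>j\<ge>N. (LINT x|M. (cmod (k i x - k j x))\<^sup>2) < e"
  shows "\<exists>h\<in>borel_measurable M. integrable M (\<lambda>x. (cmod (h x))\<^sup>2) \<and>
    (\<lambda>n. LINT x|M. (cmod (k n x - h x))\<^sup>2) \<longlonglongrightarrow> 0"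
proof -
  interpret sigma_finite_measure M by fact
  obtain w0 where w0: "w0 \<in> borel_measurable M" "integral\<^sup>N M w0 \<noteq> \<infinity>"
      "\<And>x. x \<in> space M \<Longrightarrow> 0 < w0 x \<and> w0 x < \<infinity>"
    using Ex_finite_integrable_function by blast
  \<comment> \<open>A positive weight in L2 turns L2-Cauchy sequences into L1-Cauchy ones.\<close>
  define w where "w x = complex_of_real (sqrt (enn2real (w0 x)))" for x
  have wm [measurable]: "w \<in> borel_measurable M" unfolding w_def using w0(1) by measurable
  have wpos: "w x \<noteq> 0" if "x \<in> space M" for x
    using w0(3)[OF that] by (auto simp: w_def enn2real_eq_0_iff)
  have wi: "integrable M (\<lambda>x. (cmod (w x))\<^sup>2)"
  proof (rule integrableI_bounded)
    have "(\<integral>\<^sup>+x. ennreal (norm ((cmod (w x))\<^sup>2)) \<partial>M) = integral\<^sup>N M w0"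
      using w0(3) by (intro nn_integral_cong) (simp add: w_def)
    then show "(\<integral>\<^sup>+x. ennreal (norm ((cmod (w x))\<^sup>2)) \<partial>M) < \<infinity>"
      using w0(2) by (simp add: less_top)
  qed measurable
  define W where "W = sqrt (LINT x|M. (cmod (w x))\<^sup>2)"
  have di: "integrable M (\<lambda>x. (cmod (k i x - k j x))\<^sup>2)" for i j
    by (intro integrable_diff_L2 k) auto
  have si: "integrable M (\<lambda>x. w x * k n x)" for n
    by (intro integrable_mult_L2 wi k) auto
  have L1_Cauchy: "\<exists>N. \<forall>i\<ge>N. \<forall>j\<ge>N. (LINT x|M. norm (w x * k i x - w x * k j x)) < e"
    if "e > 0" for e
  proof -
    have W: "W \<ge> 0" by (simp add: W_def)
    \<comment> \<open>The denominator is \<open>W + 1\<close> because \<open>W\<close> is 0 when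
      \<open>M\<close> is the null measure.\<close>
    then have "(e / (W + 1))\<^sup>2 > 0" using that by (intro zero_less_power divide_pos_pos) auto
    then obtain N where N: "\<And>i j. i \<ge> N \<Longrightarrow> j \<ge> N \<Longrightarrow>
        (LINT x|M. (cmod (k i x - k j x))\<^sup>2) < (e / (W + 1))\<^sup>2"
      using Cauchy by meson
    have "(LINT x|M. norm (w x * k i x - w x * k j x)) < e" if "i \<ge> N" "j \<ge> N" for i j
    proof -
      have "(LINT x|M. norm (w x * k i x - w x * k j x)) = (LINT x|M. cmod (w x) * cmod (k i x - k j x))"
        by (simp add: norm_mult flip: right_diff_distrib)
      also have "\<dots> \<le> W * sqrt (LINT x|M. (cmod (k i x - k j x))\<^sup>2)"
        unfolding W_def by (intro Cauchy_Schwarz_L2 wi di) auto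
      also have "\<dots> \<le> W * (e / (W + 1))"
        using N[OF that] \<open>e > 0\<close> W
        by (intro mult_left_mono real_le_lsqrt) (auto intro: less_imp_le)
      also have "\<dots> < e" using \<open>e > 0\<close> W by (simp add: field_simps)
      finally show ?thesis .
    qed
    then show ?thesis by blast
  qed
  obtain r where r: "strict_mono r" "AE x in M. Cauchy (\<lambda>i. w x * k (r i) x)"
    using cauchy_L1_AE_cauchy_subseq[of M "\<lambda>n x. w x * k n x", OF si L1_Cauchy] by metis
  define h where "h x = lim (\<lambda>i. k (r i) x)" for x
  have hm [measurable]: "h \<in> borel_measurable M" unfolding h_def by measurable
  have pt: "AE x in M. (\<lambda>i. k (r i) x) \<longlonglongrightarrow> h x"
    using r(2) AE_space
  proof eventually_elim
    case (elim x)
    then obtain l where "(\<lambda>i. w x * k (r i) x) \<longlonglongrightarrow> l"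
      by (auto simp: Cauchy_convergent_iff convergent_def)
    then have "(\<lambda>i. inverse (w x) * (w x * k (r i) x)) \<longlonglongrightarrow> inverse (w x) * l"
      by (intro tendsto_intros)
    then have "convergent (\<lambda>i. k (r i) x)"
      using wpos[OF elim(2)] by (auto simp: convergent_def mult.assoc[symmetric])
    then show ?case unfolding h_def by (simp add: convergent_LIMSEQ_iff)
  qed
  \<comment> \<open>Fatou along the subsequence with \<open>k n\<close> held fixed. This one
    estimate gives both that \<open>h\<close> is in L2 and that the whole sequence
    converges.\<close>
  have close: "\<exists>N. \<forall>n\<ge>N. integrable M (\<lambda>x. (cmod (h x - k n x))\<^sup>2) \<and> (LINT x|M. (cmod (h x - k n x))\<^sup>2) \<le> e"
    if "e > 0" for e
  proof -
    obtain N where N: "\<And>i j. i \<ge> N \<Longrightarrow> j \<ge> N \<Longrightarrow> (LINT x|M. (cmod (k i x - k j x))\<^sup>2) < e"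
      using Cauchy \<open>e > 0\<close> by meson
    have "eventually (\<lambda>i. (LINT x|M. (cmod (k (r i) x - k n x))\<^sup>2) \<le> e) sequentially" if "n \<ge> N" for n
      using eventually_ge_at_top[of N]
      by eventually_elim (use N[OF _ that] seq_suble[OF r(1)] in \<open>meson less_imp_le order.trans\<close>)
    from L2_Fatou[OF _ hm _ di this pt] show ?thesis by auto
  qed
  obtain n where "integrable M (\<lambda>x. (cmod (h x - k n x))\<^sup>2)" using close[of 1] by auto
  then have "integrable M (\<lambda>x. (cmod ((h x - k n x) - (- k n x)))\<^sup>2)"
    by (rule integrable_diff_L2[rotated 2]) (simp_all add: k)
  then have hi: "integrable M (\<lambda>x. (cmod (h x))\<^sup>2)" by simp
  have "(\<lambda>n. LINT x|M. (cmod (k n x - h x))\<^sup>2) \<longlonglongrightarrow> 0"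
  proof (rule LIMSEQ_I)
    fix e :: real assume "e > 0"
    then obtain N where "\<And>n. n \<ge> N \<Longrightarrow> (LINT x|M. (cmod (h x - k n x))\<^sup>2) \<le> e / 2"
      using close[of "e / 2"] by auto
    then show "\<exists>N. \<forall>n\<ge>N. norm ((LINT x|M. (cmod (k n x - h x))\<^sup>2) - 0) < e"
      using \<open>e > 0\<close> by (intro exI[of _ N]) (force simp: norm_minus_commute)
  qed
  with hi show ?thesis by (intro bexI[of _ h]) auto
qed

section \<open>Fourier inversion\<close>

text \<open>The positive sign and the missing normalisation match the factor \<bar>x\<bar>^(i
  \<tau>) of the Mellin kernel at x = exp t; inversion therefore carries
  \<open>cis (- (\<tau> * s))\<close> and a factor 2 pi.\<close>

definition fourier :: "(real \<Rightarrow> complex) \<Rightarrow> real \<Rightarrow> complex" where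
  "fourier g \<tau> = (LINT t|lborel. g t * cis (\<tau> * t))"

lemma borel_measurable_cis [measurable (raw)]:
  "f \<in> borel_measurable M \<Longrightarrow> (\<lambda>x. cis (f x)) \<in> borel_measurable M"
  by (rule measurable_compose[OF _ borel_measurable_continuous_onI]) (auto intro: continuous_intros)

lemma borel_measurable_cnj [measurable (raw)]:
  "f \<in> borel_measurable M \<Longrightarrow> (\<lambda>x. cnj (f x)) \<in> borel_measurable M"
  by (rule measurable_compose[OF _ borel_measurable_continuous_onI]) (auto intro: continuous_intros)

lemma integrable_mult_cis:
  fixes g :: "real \<Rightarrow> complex"
  assumes g: "integrable lborel g" and [measurable]: "\<theta> \<in> borel_measurable borel"
  shows "integrable lborel (\<lambda>t. g t * cis (\<theta> t))"
proof -
  have [measurable]: "g \<in> borel_measurable borel" using g by auto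
  show ?thesis
    by (rule Bochner_Integration.integrable_bound[OF g]) (auto simp: norm_mult)
qed

lemma borel_measurable_fourier [measurable]:
  assumes [measurable]: "g \<in> borel_measurable borel"
  shows "fourier g \<in> borel_measurable borel"
  unfolding fourier_def by measurable

lemma cmod_fourier_le:
  assumes g: "integrable lborel g"
  shows "cmod (fourier g \<tau>) \<le> (LINT t|lborel. cmod (g t))"
  unfolding fourier_def
  by (rule norm_integral_le_integral) (auto simp: norm_mult intro!: integrable_mult_cis g integrable_norm)

lemma fourier_std_normal_density:
  "fourier (\<lambda>x. of_real (std_normal_density x)) \<tau> = of_real (exp (- \<tau>\<^sup>2 / 2))"
proof -
  have "fourier (\<lambda>x. of_real (std_normal_density x)) \<tau> = char std_normal_distribution \<tau>"
    unfolding char_def fourier_def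
    by (subst integral_density) (auto simp: cis_conv_exp scaleR_conv_of_real)
  then show ?thesis by (simp add: char_std_normal_distribution)
qed

lemma integrable_std_normal_density_affine:
  assumes "c \<noteq> 0"
  shows "integrable lborel (\<lambda>x. std_normal_density (t + c * x))"
  using assms by (simp add: lborel_integrable_real_affine_iff)

text \<open>Damping frequencies by a Gaussian of width 1 / \<epsilon> becomes averaging in u at
  scale \<epsilon>; this is the kernel of the regularisation below.\<close>

lemma fourier_std_normal_density_scaled:
  assumes "\<epsilon> > 0"
  shows "(LINT \<tau>|lborel. of_real (std_normal_density (\<epsilon> * \<tau>)) * cis (\<tau> * u)) =
    of_real (sqrt (2 * pi) / \<epsilon> * std_normal_density (u / \<epsilon>))"
proof -
  have "(LINT \<tau>|lborel. of_real (std_normal_density (\<epsilon> * \<tau>)) * cis (\<tau> * u)) =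
     of_real (1 / \<epsilon>) * fourier (\<lambda>x. of_real (std_normal_density x)) (u / \<epsilon>)"
    unfolding fourier_def
    using assms by (subst lborel_integral_real_affine[where c = "1 / \<epsilon>" and t = 0])
      (auto simp: scaleR_conv_of_real mult_ac)
  also have "\<dots> = of_real (sqrt (2 * pi) / \<epsilon> * std_normal_density (u / \<epsilon>))"
    unfolding fourier_std_normal_density by (simp add: std_normal_density_def power_divide)
  finally show ?thesis .
qed

lemma std_normal_density_le: "std_normal_density x \<le> std_normal_density 0"
  by (simp add: std_normal_density_def divide_right_mono)

text \<open>\<open>fourier A\<close> is bounded but perhaps not integrable, so inverting it directly
  would be a meaningless exchange of integrals. The Gaussian factor makes the double integral
  absolutely convergent, and Fubini leaves a Gaussian average of \<open>A\<close> around s.\<close>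

lemma fourier_gaussian_regularization:
  fixes A :: "real \<Rightarrow> complex"
  assumes A: "integrable lborel A" and \<epsilon>: "\<epsilon> > 0"
  shows "(LINT \<tau>|lborel. fourier A \<tau> * of_real (std_normal_density (\<epsilon> * \<tau>)) * cis (- (\<tau> * s))) =
    of_real (sqrt (2 * pi)) * (LINT v|lborel. A (s + \<epsilon> * v) * of_real (std_normal_density v))"
proof -
  define k where "k \<tau> u = A u * of_real (std_normal_density (\<epsilon> * \<tau>)) * cis (\<tau> * (u - s))" for \<tau> u
  have [measurable]: "A \<in> borel_measurable borel" using A by auto
  have iN: "integrable lborel (\<lambda>\<tau>. std_normal_density (\<epsilon> * \<tau>))"
    using integrable_std_normal_density_affine[of \<epsilon> 0] \<epsilon> by simp
  have ik: "integrable lborel (\<lambda>u. k \<tau> u)" for \<tau>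
    unfolding k_def by (intro integrable_mult_cis integrable_mult_left A) auto
  have "integrable (lborel \<Otimes>\<^sub>M lborel) (case_prod k)"
  proof (rule lborel_pair.Fubini_integrable)
    show "case_prod k \<in> borel_measurable (lborel \<Otimes>\<^sub>M lborel)" unfolding k_def by measurable
    show "integrable lborel (\<lambda>\<tau>. LINT u|lborel. norm (case_prod k (\<tau>, u)))"
      using iN by (simp add: k_def norm_mult)
    show "AE \<tau> in lborel. integrable lborel (\<lambda>u. case_prod k (\<tau>, u))" using ik by simp
  qed
  then have F: "(LINT \<tau>|lborel. LINT u|lborel. k \<tau> u) = (LINT u|lborel. LINT \<tau>|lborel. k \<tau> u)"
    by (rule lborel_pair.Fubini_integral[symmetric])
  have "(LINT u|lborel. k \<tau> u) = fourier A \<tau> * of_real (std_normal_density (\<epsilon> * \<tau>)) * cis (- (\<tau> * s))" for \<tau>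
  proof -
    have "(LINT u|lborel. k \<tau> u) = (LINT u|lborel. (A u * cis (\<tau> * u)) *
        (of_real (std_normal_density (\<epsilon> * \<tau>)) * cis (- (\<tau> * s))))"
    proof -
      have "cis (\<tau> * (u - s)) = cis (\<tau> * u) * cis (- (\<tau> * s))" for u
        by (simp add: cis_mult right_diff_distrib)
      then show ?thesis unfolding k_def by (simp add: mult_ac)
    qed
    also have "\<dots> = fourier A \<tau> * (of_real (std_normal_density (\<epsilon> * \<tau>)) * cis (- (\<tau> * s)))"
      unfolding fourier_def by (rule integral_mult_left_zero)
    finally show ?thesis by (simp add: mult.assoc)
  qed
  then have "(LINT \<tau>|lborel. fourier A \<tau> * of_real (std_normal_density (\<epsilon> * \<tau>)) * cis (- (\<tau> * s))) =
      (LINT u|lborel. LINT \<tau>|lborel. k \<tau> u)" using F by simp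
  also have "\<dots> = (LINT u|lborel. A u * of_real (sqrt (2 * pi) / \<epsilon> * std_normal_density ((u - s) / \<epsilon>)))"
  proof (rule Bochner_Integration.integral_cong[OF refl])
    fix u
    have "(LINT \<tau>|lborel. k \<tau> u) = (LINT \<tau>|lborel. A u * (of_real (std_normal_density (\<epsilon> * \<tau>)) * cis (\<tau> * (u - s))))"
      unfolding k_def by (simp add: mult.assoc)
    also have "\<dots> = A u * (LINT \<tau>|lborel. of_real (std_normal_density (\<epsilon> * \<tau>)) * cis (\<tau> * (u - s)))"
      by (rule integral_mult_right_zero)
    finally show "(LINT \<tau>|lborel. k \<tau> u) = A u * of_real (sqrt (2 * pi) / \<epsilon> * std_normal_density ((u - s) / \<epsilon>))"
      by (simp only: fourier_std_normal_density_scaled[OF \<epsilon>])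
  qed
  also have "\<dots> = \<epsilon> *\<^sub>R (LINT v|lborel. A (s + \<epsilon> * v) * of_real (sqrt (2 * pi) / \<epsilon> * std_normal_density v))"
    using \<epsilon> by (subst lborel_integral_real_affine[where c = \<epsilon> and t = s]) auto
  also have "\<dots> = \<epsilon> *\<^sub>R (LINT v|lborel. of_real (sqrt (2 * pi) / \<epsilon>) * (A (s + \<epsilon> * v) * of_real (std_normal_density v)))"
    by (simp add: mult_ac)
  also have "\<dots> = of_real (sqrt (2 * pi)) * (LINT v|lborel. A (s + \<epsilon> * v) * of_real (std_normal_density v))"
    using \<epsilon> by (simp only: integral_mult_right_zero) (simp add: scaleR_conv_of_real)
  finally show ?thesis .
qed

text \<open>Nonnegativity takes the place of the usual assumption that the transform is integrable:
  the regularised integrals are bounded because \<open>A\<close> is, and monotonicity of mass in the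
  limit (Fatou) yields integrability. Afterwards dominated convergence removes the regularisation on
  both sides.\<close>

theorem fourier_inversion_nonneg:
  fixes A :: "real \<Rightarrow> complex" and r :: "real \<Rightarrow> real"
  assumes A: "integrable lborel A" and cont: "continuous_on UNIV A"
    and bnd: "\<And>u. cmod (A u) \<le> B"
    and r: "\<And>\<tau>. fourier A \<tau> = of_real (r \<tau>)" and nonneg: "\<And>\<tau>. r \<tau> \<ge> 0"
  shows "integrable lborel r"
    and "(LINT \<tau>|lborel. of_real (r \<tau>) * cis (- (\<tau> * s))) = of_real (2 * pi) * A s"
proof -
  let ?N = std_normal_density
  define \<epsilon> where "\<epsilon> n = 1 / real (Suc n)" for n
  have \<epsilon>: "\<epsilon> n > 0" for n by (simp add: \<epsilon>_def)
  have \<epsilon>0: "\<epsilon> \<longlonglongrightarrow> 0" unfolding \<epsilon>_def by (rule LIMSEQ_inverse_real_of_nat[unfolded inverse_eq_divide])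
  have [measurable]: "A \<in> borel_measurable borel" using A by auto
  have r_eq: "r = (\<lambda>\<tau>. Re (fourier A \<tau>))" by (simp add: r)
  have [measurable]: "r \<in> borel_measurable borel" unfolding r_eq by measurable
  have N0: "?N 0 = 1 / sqrt (2 * pi)" by (simp add: std_normal_density_def)
  have Nlim: "(\<lambda>n. ?N (\<epsilon> n * x)) \<longlonglongrightarrow> ?N 0" for x
  proof -
    have "(\<lambda>n. ?N (\<epsilon> n * x)) \<longlonglongrightarrow> ?N (0 * x)"
      unfolding std_normal_density_def by (intro tendsto_intros \<epsilon>0) auto
    then show ?thesis by simp
  qed
  have reg: "(LINT \<tau>|lborel. of_real (r \<tau> * ?N (\<epsilon> n * \<tau>)) * cis (- (\<tau> * s))) =
    of_real (sqrt (2 * pi)) * (LINT v|lborel. A (s + \<epsilon> n * v) * of_real (?N v))" for n s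
    using fourier_gaussian_regularization[OF A \<epsilon>[of n], of s] by (simp add: r)
  have iA: "integrable lborel (\<lambda>v. A (s + \<epsilon> n * v) * of_real (?N v))" for n s
  proof (rule Bochner_Integration.integrable_bound)
    show "integrable lborel (\<lambda>v. B * ?N v)" by simp
    show "AE v in lborel. cmod (A (s + \<epsilon> n * v) * of_real (?N v)) \<le> norm (B * ?N v)"
      using bnd by (auto simp: norm_mult abs_mult intro!: mult_right_mono order.trans[OF bnd])
  qed measurable
  have ir: "integrable lborel (\<lambda>\<tau>. r \<tau> * ?N (\<epsilon> n * \<tau>))" for n
  proof (rule Bochner_Integration.integrable_bound)
    show "integrable lborel (\<lambda>\<tau>. (LINT t|lborel. cmod (A t)) * ?N (\<epsilon> n * \<tau>))"
      using integrable_std_normal_density_affine[of "\<epsilon> n" 0] \<epsilon>[of n] by simp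
    show "AE \<tau> in lborel. norm (r \<tau> * ?N (\<epsilon> n * \<tau>)) \<le> norm ((LINT t|lborel. cmod (A t)) * ?N (\<epsilon> n * \<tau>))"
      using cmod_fourier_le[OF A] nonneg by (auto simp: r abs_mult intro!: mult_right_mono)
  qed measurable
  have rB: "(LINT \<tau>|lborel. r \<tau> * ?N (\<epsilon> n * \<tau>)) \<le> sqrt (2 * pi) * B" for n
  proof -
    \<comment> \<open>At s = 0 the character is 1, so the regularised inversion integral is the real
      integral that has to be bounded uniformly in n.\<close>
    have "of_real (LINT \<tau>|lborel. r \<tau> * ?N (\<epsilon> n * \<tau>)) =
        of_real (sqrt (2 * pi)) * (LINT v|lborel. A (0 + \<epsilon> n * v) * of_real (?N v))"
      using reg[of n 0] by (simp flip: integral_complex_of_real)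
    then have "(LINT \<tau>|lborel. r \<tau> * ?N (\<epsilon> n * \<tau>)) \<le>
        cmod (of_real (sqrt (2 * pi)) * (LINT v|lborel. A (0 + \<epsilon> n * v) * of_real (?N v)))"
      by (metis abs_ge_self norm_of_real)
    also have "\<dots> = sqrt (2 * pi) * cmod (LINT v|lborel. A (0 + \<epsilon> n * v) * of_real (?N v))"
      by (simp add: norm_mult)
    also have "cmod (LINT v|lborel. A (0 + \<epsilon> n * v) * of_real (?N v)) \<le> (LINT v|lborel. B * ?N v)"
      by (rule norm_integral_le_integral[OF iA]) (use bnd in \<open>auto simp: norm_mult intro!: mult_right_mono\<close>)
    also have "\<dots> = B" by simp
    finally show ?thesis by simp
  qed
  \<comment> \<open>As \<epsilon> n tends to 0 the weight tends to the constant \<open>?N 0\<close>.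
    Fatou is used because a dominating function is available only once r is known to be
    integrable.\<close>
  have "(\<integral>\<^sup>+\<tau>. ennreal (r \<tau> * ?N 0) \<partial>lborel) = (\<integral>\<^sup>+\<tau>. liminf (\<lambda>n. ennreal (r \<tau> * ?N (\<epsilon> n * \<tau>))) \<partial>lborel)"
    by (intro nn_integral_cong lim_imp_Liminf[symmetric] tendsto_ennrealI tendsto_mult tendsto_const Nlim) simp
  also have "\<dots> \<le> liminf (\<lambda>n. \<integral>\<^sup>+\<tau>. ennreal (r \<tau> * ?N (\<epsilon> n * \<tau>)) \<partial>lborel)"
    by (intro nn_integral_liminf) measurable
  also have "\<dots> = liminf (\<lambda>n. ennreal (LINT \<tau>|lborel. r \<tau> * ?N (\<epsilon> n * \<tau>)))"
    using nonneg by (simp add: nn_integral_eq_integral ir)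
  also have "\<dots> \<le> liminf (\<lambda>n. ennreal (sqrt (2 * pi) * B))"
    by (intro Liminf_mono always_eventually allI ennreal_leI rB)
  also have "\<dots> = ennreal (sqrt (2 * pi) * B)" by (simp add: Liminf_const)
  finally have "(\<integral>\<^sup>+\<tau>. ennreal (r \<tau> * ?N 0) \<partial>lborel) < \<infinity>" by (auto simp: less_top[symmetric] top_unique)
  then have "integrable lborel (\<lambda>\<tau>. r \<tau> * ?N 0)"
    using nonneg by (intro integrableI_nonneg) auto
  then have "integrable lborel (\<lambda>\<tau>. r \<tau> * ?N 0 * sqrt (2 * pi))" by (rule integrable_mult_left)
  then show int: "integrable lborel r" by (simp add: N0)
  have "(\<lambda>n. LINT \<tau>|lborel. of_real (r \<tau> * ?N (\<epsilon> n * \<tau>)) * cis (- (\<tau> * s))) \<longlonglongrightarrow>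
      (LINT \<tau>|lborel. of_real (r \<tau> * ?N 0) * cis (- (\<tau> * s)))"
  proof (rule integral_dominated_convergence)
    \<comment> \<open>The density is largest at 0, so this function dominates every regularised
      integrand.\<close>
    show "integrable lborel (\<lambda>\<tau>. r \<tau> * ?N 0)" using int by simp
    show "AE \<tau> in lborel. (\<lambda>n. of_real (r \<tau> * ?N (\<epsilon> n * \<tau>)) * cis (- (\<tau> * s))) \<longlonglongrightarrow>
        of_real (r \<tau> * ?N 0) * cis (- (\<tau> * s))"
      by (intro AE_I2 tendsto_mult tendsto_of_real tendsto_const Nlim)
    show "AE \<tau> in lborel. cmod (of_real (r \<tau> * ?N (\<epsilon> n * \<tau>)) * cis (- (\<tau> * s))) \<le> r \<tau> * ?N 0" for n
      using nonneg std_normal_density_le by (auto simp: norm_mult abs_mult intro!: mult_left_mono)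
  qed measurable
  \<comment> \<open>Continuity of \<open>A\<close> at s collapses the Gaussian averages to the value
    there, since the density has mass 1.\<close>
  moreover have "(\<lambda>n. of_real (sqrt (2 * pi)) * (LINT v|lborel. A (s + \<epsilon> n * v) * of_real (?N v))) \<longlonglongrightarrow>
      of_real (sqrt (2 * pi)) * (LINT v|lborel. A s * of_real (?N v))"
  proof (intro tendsto_mult tendsto_const integral_dominated_convergence)
    show "integrable lborel (\<lambda>v. B * ?N v)" by simp
    show "AE v in lborel. (\<lambda>n. A (s + \<epsilon> n * v) * of_real (?N v)) \<longlonglongrightarrow> A s * of_real (?N v)"
    proof (intro AE_I2 tendsto_mult tendsto_const)
      fix v
      have "(\<lambda>n. s + \<epsilon> n * v) \<longlonglongrightarrow> s + 0 * v" by (intro tendsto_intros \<epsilon>0)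
      moreover have "isCont A (s + 0 * v)" using cont by (auto simp: continuous_on_eq_continuous_at)
      ultimately show "(\<lambda>n. A (s + \<epsilon> n * v)) \<longlonglongrightarrow> A s"
        by (auto dest: isCont_tendsto_compose)
    qed
    show "AE v in lborel. cmod (A (s + \<epsilon> n * v) * of_real (?N v)) \<le> B * ?N v" for n
      using bnd by (auto simp: norm_mult intro!: mult_right_mono)
  qed measurable
  ultimately have "(LINT \<tau>|lborel. of_real (r \<tau> * ?N 0) * cis (- (\<tau> * s))) =
      of_real (sqrt (2 * pi)) * (LINT v|lborel. A s * of_real (?N v))"
    unfolding reg by (rule LIMSEQ_unique)
  moreover have "(LINT v|lborel. A s * of_real (?N v)) = A s"
    by (simp only: integral_mult_right_zero integral_complex_of_real) simp
  moreover have "(LINT \<tau>|lborel. of_real (r \<tau> * ?N 0) * cis (- (\<tau> * s))) =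
      of_real (?N 0) * (LINT \<tau>|lborel. of_real (r \<tau>) * cis (- (\<tau> * s)))"
    by (simp only: integral_mult_right_zero[symmetric] of_real_mult mult_ac)
  ultimately have "of_real (?N 0) * (LINT \<tau>|lborel. of_real (r \<tau>) * cis (- (\<tau> * s))) = of_real (sqrt (2 * pi)) * A s"
    by simp
  then have "of_real (sqrt (2 * pi)) * (of_real (?N 0) * (LINT \<tau>|lborel. of_real (r \<tau>) * cis (- (\<tau> * s)))) =
      of_real (sqrt (2 * pi)) * (of_real (sqrt (2 * pi)) * A s)" by simp
  then show "(LINT \<tau>|lborel. of_real (r \<tau>) * cis (- (\<tau> * s))) = of_real (2 * pi) * A s"
    by (simp add: N0 mult.assoc[symmetric] flip: of_real_mult)
qed

section \<open>Autocorrelations\<close>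

definition autocorrelation :: "(real \<Rightarrow> complex) \<Rightarrow> real \<Rightarrow> complex" where
  "autocorrelation g u = (LINT t|lborel. cnj (g t) * g (t + u))"

lemma integrable_indicator_Icc [simp]: "integrable lborel (indicat_real {a..b::real})"
  by (rule integrable_real_indicator) (auto simp: emeasure_lborel_Icc_eq)

lemma integrable_bounded_support:
  fixes g :: "real \<Rightarrow> complex"
  assumes [measurable]: "g \<in> borel_measurable borel"
    and bnd: "\<And>t. cmod (g t) \<le> B" and supp: "\<And>t. L < \<bar>t\<bar> \<Longrightarrow> g t = 0"
  shows "integrable lborel g"
proof (rule Bochner_Integration.integrable_bound)
  show "integrable lborel (\<lambda>t. B * indicator {-L..L} t :: real)" by simp
  show "AE t in lborel. cmod (g t) \<le> norm (B * indicator {-L..L} t :: real)"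
    using bnd supp by (intro AE_I2) (force simp: indicator_def abs_mult intro: order.trans[OF bnd])
qed simp

lemma continuous_on_integral_translate:
  fixes p k :: "real \<Rightarrow> complex"
  assumes p: "integrable lborel p" and k: "continuous_on UNIV k" and bnd: "\<And>t. cmod (k t) \<le> B"
  shows "continuous_on UNIV (\<lambda>u. LINT t|lborel. p t * k (t + u))"
proof (rule continuous_on_sequentiallyI)
  fix v :: "nat \<Rightarrow> real" and u assume "v \<longlonglongrightarrow> u"
  have [measurable]: "p \<in> borel_measurable borel" "k \<in> borel_measurable borel"
    using p k by (auto intro: borel_measurable_continuous_onI)
  show "(\<lambda>n. LINT t|lborel. p t * k (t + v n)) \<longlonglongrightarrow> (LINT t|lborel. p t * k (t + u))"
  proof (rule integral_dominated_convergence)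
    show "integrable lborel (\<lambda>t. B * cmod (p t))" using p by simp
    show "AE t in lborel. (\<lambda>n. p t * k (t + v n)) \<longlonglongrightarrow> p t * k (t + u)"
    proof (intro AE_I2 tendsto_mult tendsto_const)
      fix t
      have "isCont k (t + u)" using k by (auto simp: continuous_on_eq_continuous_at)
      then show "(\<lambda>n. k (t + v n)) \<longlonglongrightarrow> k (t + u)"
        using \<open>v \<longlonglongrightarrow> u\<close> by (intro isCont_tendsto_compose[of _ k] tendsto_intros)
    qed
    show "AE t in lborel. cmod (p t * k (t + v n)) \<le> B * cmod (p t)" for n
      using bnd by (auto simp: norm_mult mult.commute[of B] intro!: mult_left_mono)
  qed measurable
qed

text \<open>Continuous functions converging to g off a null set may be unbounded. Projecting their
  values onto the closed disc of radius B is continuous and fixes the values of g, so it restores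
  the bound without changing the limit.\<close>

lemma bounded_borel_AE_limit_continuous:
  fixes g :: "real \<Rightarrow> complex"
  assumes "g \<in> borel_measurable borel" and bnd: "\<And>t. cmod (g t) \<le> B"
  obtains k where "\<And>n::nat. continuous_on UNIV (k n)" "\<And>n t. cmod (k n t) \<le> B"
    "AE t in lborel. (\<lambda>n. k n t) \<longlonglongrightarrow> g t"
proof -
  have B: "B \<ge> 0" using bnd[of 0] norm_ge_zero order.trans by blast
  have "g measurable_on UNIV"
    using assms(1) by (intro lebesgue_measurable_imp_measurable_on) (auto intro: measurable_completion)
  then obtain N h where N: "negligible N" and h: "\<And>n. continuous_on UNIV (h n)"
      and lim: "\<And>x. x \<notin> N \<Longrightarrow> (\<lambda>n. h n x) \<longlonglongrightarrow> g x"
    by (auto simp: measurable_on_def)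
  define c where "c = closest_point (cball (0::complex) B)"
  have c: "continuous_on UNIV c" and cB: "cmod (c z) \<le> B" and cs: "cmod z \<le> B \<Longrightarrow> c z = z" for z
    using B closest_point_in_set[of "cball (0::complex) B" z]
    by (auto simp: c_def closest_point_self intro!: continuous_on_closest_point)
  show ?thesis
  proof
    show "continuous_on UNIV (\<lambda>t. c (h n t))" for n
      using continuous_on_compose2[OF c h] by auto
    show "cmod (c (h n t)) \<le> B" for n t by (rule cB)
    have "AE x in lebesgue. x \<notin> N"
      using N by (simp add: negligible_iff_null_sets AE_not_in)
    then have "AE x in lborel. x \<notin> N" by (simp add: AE_completion_iff)
    then show "AE t in lborel. (\<lambda>n. c (h n t)) \<longlonglongrightarrow> g t"
    proof eventually_elim
      case (elim t)
      have "isCont c (g t)" using c by (auto simp: continuous_on_eq_continuous_at)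
      from isCont_tendsto_compose[OF this lim[OF elim]] show ?case by (simp add: cs bnd)
    qed
  qed
qed

text \<open>As g is merely measurable, its translates need not converge pointwise. The shifted
  factor is replaced by continuous functions, and the resulting error is at most B times an L1 error
  that does not depend on the shift, so the limit is locally uniform.\<close>

lemma continuous_on_autocorrelation:
  fixes g :: "real \<Rightarrow> complex"
  assumes [measurable]: "g \<in> borel_measurable borel"
    and bnd: "\<And>t. cmod (g t) \<le> B" and supp: "\<And>t. L < \<bar>t\<bar> \<Longrightarrow> g t = 0"
  shows "continuous_on UNIV (autocorrelation g)"
proof -
  have B: "B \<ge> 0" using bnd[of 0] norm_ge_zero order.trans by blast
  have ig: "integrable lborel g" by (rule integrable_bounded_support[OF assms])
  obtain k where k: "\<And>n::nat. continuous_on UNIV (k n)" and kB: "\<And>n t. cmod (k n t) \<le> B"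
    and lim: "AE t in lborel. (\<lambda>n. k n t) \<longlonglongrightarrow> g t"
    using bounded_borel_AE_limit_continuous[OF assms(1) bnd] by metis
  have [measurable]: "k n \<in> borel_measurable borel" for n
    using k by (rule borel_measurable_continuous_onI)
  define A where "A n u = (LINT t|lborel. cnj (g t) * k n (t + u))" for n u
  have cA: "continuous_on UNIV (A n)" for n
    unfolding A_def using ig by (intro continuous_on_integral_translate[OF _ k kB]) simp
  have mult_int: "integrable lborel (\<lambda>t. cnj (g t) * q (t + u))"
    if [measurable]: "q \<in> borel_measurable borel" and "\<And>t. cmod (q t) \<le> B" for q u
  proof (rule Bochner_Integration.integrable_bound)
    show "integrable lborel (\<lambda>t. B * cmod (g t))" using ig by simp
    show "AE t in lborel. cmod (cnj (g t) * q (t + u)) \<le> norm (B * cmod (g t))"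
      using that B by (auto simp: norm_mult mult.commute[of B] intro!: mult_left_mono)
  qed measurable
  \<comment> \<open>The \<open>k n\<close> are bounded but need not be small far out, so their L1
    error is controlled on bounded sets only. With \<bar>t\<bar> \<le> L and \<bar>u\<bar> < R the
    point t + u stays in {-(L+R)..L+R}.\<close>
  have cont: "continuous_on {-R<..<R} (autocorrelation g)" if "R > 0" for R
  proof (rule uniform_limit_theorem)
    show "\<forall>\<^sub>F n in sequentially. continuous_on {-R<..<R} (A n)"
      using continuous_on_subset[OF cA] by auto
    define d where "d n = (LINT x|lborel. indicator {-(L+R)..L+R} x * cmod (g x - k n x))" for n
    have gk: "cmod (g x - k n x) \<le> 2 * B" for n x
      using norm_triangle_ineq4[of "g x" "k n x"] bnd[of x] kB[of n x] by linarith
    have ii: "integrable lborel (\<lambda>x. indicator {-(L+R)..L+R} x * cmod (g x - k n x))" for n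
    proof (rule Bochner_Integration.integrable_bound)
      show "integrable lborel (\<lambda>x. 2 * B * indicator {-(L+R)..L+R} x :: real)" by simp
      show "AE x in lborel. norm (indicator {-(L+R)..L+R} x * cmod (g x - k n x)) \<le>
          norm (2 * B * indicator {-(L+R)..L+R} x :: real)"
        using gk B by (auto simp: indicator_def)
    qed measurable
    have d0: "d \<longlonglongrightarrow> 0"
    proof -
      have "d \<longlonglongrightarrow> (LINT x|(lborel :: real measure). 0)" unfolding d_def
      proof (rule integral_dominated_convergence)
        show "integrable lborel (\<lambda>x. 2 * B * indicator {-(L+R)..L+R} x :: real)" by simp
        show "AE x in lborel. (\<lambda>n. indicator {-(L+R)..L+R} x * cmod (g x - k n x)) \<longlonglongrightarrow> 0"
          using lim
        proof eventually_elim
          case (elim x)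
          have "(\<lambda>n. indicator {-(L+R)..L+R} x * cmod (g x - k n x)) \<longlonglongrightarrow>
             indicator {-(L+R)..L+R} x * cmod (g x - g x)"
            by (intro tendsto_intros elim)
          then show ?case by simp
        qed
        show "AE x in lborel. norm (indicator {-(L+R)..L+R} x * cmod (g x - k n x)) \<le>
          2 * B * indicator {-(L+R)..L+R} x" for n
          using gk B by (auto simp: indicator_def)
      qed measurable
      then show ?thesis by simp
    qed
    have est: "cmod (A n u - autocorrelation g u) \<le> B * d n" if u: "u \<in> {-R<..<R}" for n u
    proof -
      have "A n u - autocorrelation g u = (LINT t|lborel. cnj (g t) * k n (t + u) - cnj (g t) * g (t + u))"
        unfolding A_def autocorrelation_def
        by (intro Bochner_Integration.integral_diff[symmetric] mult_int bnd kB) auto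
      also have "cmod \<dots> \<le> (LINT t|lborel. B * (indicator {-(L+R)..L+R} (t + u) * cmod (g (t + u) - k n (t + u))))"
      proof (rule norm_integral_le_integral)
        show "integrable lborel (\<lambda>t. cnj (g t) * k n (t + u) - cnj (g t) * g (t + u))"
          by (intro Bochner_Integration.integrable_diff mult_int bnd kB) auto
        show "integrable lborel (\<lambda>t. B * (indicator {-(L+R)..L+R} (t + u) * cmod (g (t + u) - k n (t + u))))"
          using lborel_integrable_real_affine[OF ii, of 1 u n] by (simp add: add.commute)
        fix t
        have "cmod (cnj (g t) * k n (t + u) - cnj (g t) * g (t + u)) = cmod (g t) * cmod (g (t + u) - k n (t + u))"
          by (simp add: norm_mult norm_minus_commute flip: right_diff_distrib)
        also have "\<dots> \<le> B * (indicator {-(L+R)..L+R} (t + u) * cmod (g (t + u) - k n (t + u)))"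
        proof (cases "L < \<bar>t\<bar>")
          case True
          then show ?thesis using B by (simp add: supp)
        next
          case False
          then have "t + u \<in> {-(L+R)..L+R}" using u by auto
          then show ?thesis using bnd by (auto intro!: mult_right_mono)
        qed
        finally show "cmod (cnj (g t) * k n (t + u) - cnj (g t) * g (t + u)) \<le>
          B * (indicator {-(L+R)..L+R} (t + u) * cmod (g (t + u) - k n (t + u)))" .
      qed
      also have "\<dots> = B * (LINT t|lborel. indicator {-(L+R)..L+R} (t + u) * cmod (g (t + u) - k n (t + u)))"
        by simp
      also have "(LINT t|lborel. indicator {-(L+R)..L+R} (t + u) * cmod (g (t + u) - k n (t + u))) = d n"
        unfolding d_def by (subst (2) lborel_integral_real_affine[where c = 1 and t = u]) (auto simp: add.commute)
      finally show ?thesis .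
    qed
    show "uniform_limit {-R<..<R} A (autocorrelation g) sequentially"
    proof (rule uniform_limitI)
      fix e :: real assume "e > 0"
      have "(\<lambda>n. B * d n) \<longlonglongrightarrow> B * 0" by (intro tendsto_mult tendsto_const d0)
      then have "\<forall>\<^sub>F n in sequentially. B * d n < e" using \<open>e > 0\<close> by (intro order_tendstoD(2)) auto
      then show "\<forall>\<^sub>F n in sequentially. \<forall>u\<in>{-R<..<R}. dist (A n u) (autocorrelation g u) < e"
      proof eventually_elim
        case (elim n)
        then show ?case unfolding dist_norm using est[of _ n] le_less_trans by blast
      qed
    qed
  qed simp
  have "isCont (autocorrelation g) u" for u
  proof -
    have "continuous_on {-(\<bar>u\<bar>+1)<..<\<bar>u\<bar>+1} (autocorrelation g)" by (rule cont) simp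
    then have "\<forall>x\<in>{-(\<bar>u\<bar>+1)<..<\<bar>u\<bar>+1}. isCont (autocorrelation g) x"
      by (simp only: continuous_on_eq_continuous_at open_greaterThanLessThan)
    moreover have "u \<in> {-(\<bar>u\<bar>+1)<..<\<bar>u\<bar>+1}" by auto
    ultimately show ?thesis by blast
  qed
  then show ?thesis by (simp add: continuous_on_eq_continuous_at)
qed

lemma cmod_autocorrelation_le:
  assumes g: "integrable lborel g" and bnd: "\<And>t. cmod (g t) \<le> B"
  shows "cmod (autocorrelation g u) \<le> B * (LINT t|lborel. cmod (g t))"
proof -
  have [measurable]: "g \<in> borel_measurable borel" using g by auto
  have "cmod (autocorrelation g u) \<le> (LINT t|lborel. B * cmod (g t))"
    unfolding autocorrelation_def
  proof (rule norm_integral_le_integral)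
    show i: "integrable lborel (\<lambda>t. B * cmod (g t))" using g by simp
    show le: "cmod (cnj (g t) * g (t + u)) \<le> B * cmod (g t)" for t
      using bnd by (auto simp: norm_mult mult.commute[of B] intro!: mult_left_mono)
    show "integrable lborel (\<lambda>t. cnj (g t) * g (t + u))"
      by (rule Bochner_Integration.integrable_bound[OF i])
         (use le in \<open>auto intro!: AE_I2 order.trans[OF _ abs_ge_self]\<close>)
  qed
  then show ?thesis by simp
qed

text \<open>The Wiener-Khinchin identity. By translation invariance the norm of the double integrand
  integrates to the square of the L1 norm of g, so Fubini applies; its case \<tau> = 0 also gives
  integrability of the autocorrelation.\<close>

lemma
  fixes g :: "real \<Rightarrow> complex"
  assumes g: "integrable lborel g"
  shows integrable_autocorrelation: "integrable lborel (autocorrelation g)"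
    and fourier_autocorrelation: "fourier (autocorrelation g) \<tau> = of_real ((cmod (fourier g \<tau>))\<^sup>2)"
proof -
  have [measurable]: "g \<in> borel_measurable borel" using g by auto
  define k where "k \<tau> t u = cnj (g t) * g (t + u) * cis (\<tau> * u)" for \<tau> t u
  have translate: "integrable lborel (\<lambda>u. g (t + u))" for t
    using lborel_integrable_real_affine[OF g, of 1 t] by simp
  have norm_translate: "(LINT u|lborel. cmod (g (t + u))) = (LINT u|lborel. cmod (g u))" for t
    using lborel_integral_real_affine[of 1 "\<lambda>u. cmod (g u)" t] by simp
  have ik: "integrable (lborel \<Otimes>\<^sub>M lborel) (case_prod (k \<tau>))" for \<tau>
  proof (rule lborel_pair.Fubini_integrable)
    show "case_prod (k \<tau>) \<in> borel_measurable (lborel \<Otimes>\<^sub>M lborel)" unfolding k_def by measurable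
    show "integrable lborel (\<lambda>t. LINT u|lborel. norm (case_prod (k \<tau>) (t, u)))"
      using g by (simp add: k_def norm_mult norm_translate)
    show "AE t in lborel. integrable lborel (\<lambda>u. case_prod (k \<tau>) (t, u))"
      unfolding k_def prod.case
      by (intro AE_I2 integrable_mult_cis integrable_mult_right translate) auto
  qed
  show "integrable lborel (autocorrelation g)"
    using lborel_pair.integrable_snd[OF ik[of 0]] by (simp add: k_def autocorrelation_def[abs_def])
  have "fourier (autocorrelation g) \<tau> = (LINT u|lborel. LINT t|lborel. k \<tau> t u)"
    by (simp add: fourier_def autocorrelation_def k_def)
  also have "\<dots> = (LINT t|lborel. LINT u|lborel. k \<tau> t u)"
    by (rule lborel_pair.Fubini_integral[OF ik])
  also have "\<dots> = (LINT t|lborel. cnj (g t * cis (\<tau> * t)) * fourier g \<tau>)"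
  proof (rule Bochner_Integration.integral_cong[OF refl])
    fix t
    have "(LINT u|lborel. k \<tau> t u) = (LINT u|lborel. cnj (g t * cis (\<tau> * t)) * (g (t + u) * cis (\<tau> * (t + u))))"
    proof (rule Bochner_Integration.integral_cong[OF refl])
      fix u
      have "cis (\<tau> * u) = cnj (cis (\<tau> * t)) * cis (\<tau> * (t + u))"
        by (simp add: cis_cnj cis_mult algebra_simps)
      then show "k \<tau> t u = cnj (g t * cis (\<tau> * t)) * (g (t + u) * cis (\<tau> * (t + u)))"
        by (simp add: k_def)
    qed
    also have "\<dots> = cnj (g t * cis (\<tau> * t)) * fourier g \<tau>"
      using lborel_integral_real_affine[of 1 "\<lambda>u. g u * cis (\<tau> * u)" t] by (simp add: fourier_def)
    finally show "(LINT u|lborel. k \<tau> t u) = cnj (g t * cis (\<tau> * t)) * fourier g \<tau>" .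
  qed
  also have "\<dots> = cnj (fourier g \<tau>) * fourier g \<tau>"
  proof -
    have "cnj (fourier g \<tau>) = (LINT t|lborel. cnj (g t * cis (\<tau> * t)))"
      unfolding fourier_def by (rule Bochner_Integration.integral_cnj[symmetric])
    then show ?thesis by (metis integral_mult_left_zero)
  qed
  also have "\<dots> = of_real ((cmod (fourier g \<tau>))\<^sup>2)"
    by (simp only: complex_norm_square mult.commute)
  finally show "fourier (autocorrelation g) \<tau> = of_real ((cmod (fourier g \<tau>))\<^sup>2)" .
qed

text \<open>The case s = 0 is Plancherel's identity; the other s retain the whole autocorrelation,
  which is what the comparison of correlations requires. Boundedness and bounded support supply the
  hypotheses of the inversion theorem.\<close>

theorem Plancherel_bounded_support:
  fixes g :: "real \<Rightarrow> complex"
  assumes "g \<in> borel_measurable borel"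
    and "\<And>t. cmod (g t) \<le> B" and "\<And>t. L < \<bar>t\<bar> \<Longrightarrow> g t = 0"
  shows "integrable lborel (\<lambda>\<tau>. (cmod (fourier g \<tau>))\<^sup>2)"
    and "(LINT \<tau>|lborel. of_real ((cmod (fourier g \<tau>))\<^sup>2) * cis (- (\<tau> * s))) =
      of_real (2 * pi) * autocorrelation g s"
proof -
  have g: "integrable lborel g" by (rule integrable_bounded_support[OF assms])
  note * = integrable_autocorrelation[OF g] continuous_on_autocorrelation[OF assms]
    cmod_autocorrelation_le[OF g assms(2)] fourier_autocorrelation[OF g] zero_le_power2
  show "integrable lborel (\<lambda>\<tau>. (cmod (fourier g \<tau>))\<^sup>2)"
    by (rule fourier_inversion_nonneg(1)[OF *])
  show "(LINT \<tau>|lborel. of_real ((cmod (fourier g \<tau>))\<^sup>2) * cis (- (\<tau> * s))) =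
      of_real (2 * pi) * autocorrelation g s"
    by (rule fourier_inversion_nonneg(2)[OF *])
qed

section \<open>Logarithmic coordinates\<close>

text \<open>The change of variables theorem lives over \<open>lebesgue\<close> and yields
  integrability and value together; Borel measurability of \<open>h\<close> moves both to
  \<open>lborel\<close>.\<close>

lemma
  fixes h :: "real \<Rightarrow> complex"
  assumes [measurable]: "h \<in> borel_measurable borel"
  shows integrable_exp_substitution:
      "integrable lborel (\<lambda>t. exp t *\<^sub>R h (exp t)) \<longleftrightarrow> set_integrable lborel {0<..} h"
    and integral_exp_substitution:
      "(LINT t|lborel. exp t *\<^sub>R h (exp t)) = (LINT x:{0<..}|lborel. h x)"
proof -
  have range: "exp ` UNIV = {0::real<..}"
  proof safe
    fix x :: real assume "x > 0"
    then show "x \<in> range exp" by (intro image_eqI[of _ _ "ln x"]) auto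
  qed simp
  have L: "integrable lborel (\<lambda>t. exp t *\<^sub>R h (exp t)) \<longleftrightarrow> (\<lambda>t. \<bar>exp t\<bar> *\<^sub>R h (exp t)) absolutely_integrable_on UNIV"
    by (simp add: set_integrable_def integrable_completion)
  have R: "set_integrable lborel {0<..} h \<longleftrightarrow> h absolutely_integrable_on {0<..}"
    unfolding set_integrable_def by (rule integrable_completion[symmetric]) measurable
  note cov = has_absolute_integral_change_of_variables_real[of UNIV exp exp h, unfolded range]
  have cov': "(\<lambda>t. \<bar>exp t\<bar> *\<^sub>R h (exp t)) absolutely_integrable_on UNIV \<and>
        integral UNIV (\<lambda>t. \<bar>exp t\<bar> *\<^sub>R h (exp t)) = b
      \<longleftrightarrow> h absolutely_integrable_on {0<..} \<and> integral {0<..} h = b" for b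
    by (rule cov) (auto intro: DERIV_subset[OF DERIV_exp] simp: inj_on_def)
  show iff: "integrable lborel (\<lambda>t. exp t *\<^sub>R h (exp t)) \<longleftrightarrow> set_integrable lborel {0<..} h"
    unfolding L R using cov' by blast
  show "(LINT t|lborel. exp t *\<^sub>R h (exp t)) = (LINT x:{0<..}|lborel. h x)"
  proof (cases "set_integrable lborel {0<..} h")
    case True
    then have 1: "h absolutely_integrable_on {0<..}" and
      2: "(\<lambda>t. \<bar>exp t\<bar> *\<^sub>R h (exp t)) absolutely_integrable_on UNIV"
      using iff L R by auto
    have "(LINT t|lborel. exp t *\<^sub>R h (exp t)) = (LINT t:UNIV|lebesgue. \<bar>exp t\<bar> *\<^sub>R h (exp t))"
      by (simp add: set_lebesgue_integral_def integral_completion)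
    also have "\<dots> = integral UNIV (\<lambda>t. \<bar>exp t\<bar> *\<^sub>R h (exp t))"
      by (rule set_lebesgue_integral_eq_integral(2)[OF 2])
    also have "\<dots> = integral {0<..} h" using cov' 1 by blast
    also have "\<dots> = (LINT x:{0<..}|lebesgue. h x)"
      by (rule set_lebesgue_integral_eq_integral(2)[OF 1, symmetric])
    also have "\<dots> = (LINT x:{0<..}|lborel. h x)"
      unfolding set_lebesgue_integral_def by (rule integral_completion) measurable
    finally show ?thesis .
  next
    case False
    \<comment> \<open>Integrability fails on both sides at once, and then both integrals have the
      default value 0.\<close>
    then have "\<not> integrable lborel (\<lambda>t. exp t *\<^sub>R h (exp t))" using iff by simp
    then show ?thesis
      using False by (simp add: not_integrable_integral_eq set_integrable_def set_lebesgue_integral_def)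
  qed
qed

lemma integral_exp_fold:
  fixes h :: "real \<Rightarrow> complex"
  assumes h: "integrable lborel h"
  shows "(LINT t|lborel. exp t *\<^sub>R (h (exp t) + h (- exp t))) = (LINT x|lborel. h x)"
proof -
  have [measurable]: "h \<in> borel_measurable borel" using h by auto
  have 1: "set_integrable lborel {0<..} h"
    unfolding set_integrable_def using integrable_mult_indicator[OF _ h] by simp
  have h': "integrable lborel (\<lambda>x. h (- x))"
    using lborel_integrable_real_affine[OF h, of "-1" 0] by simp
  have 2: "set_integrable lborel {0<..} (\<lambda>x. h (- x))"
    unfolding set_integrable_def using integrable_mult_indicator[OF _ h'] by simp
  have 3: "set_integrable lborel {..<0} h"
    unfolding set_integrable_def using integrable_mult_indicator[OF _ h] by simp
  have "(LINT t|lborel. exp t *\<^sub>R (h (exp t) + h (- exp t))) = (LINT x:{0<..}|lborel. h x + h (- x))"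
    by (rule integral_exp_substitution) measurable
  also have "\<dots> = (LINT x:{0<..}|lborel. h x) + (LINT x:{0<..}|lborel. h (- x))"
    using 1 2 by (rule set_integral_add)
  also have "(LINT x:{0<..}|lborel. h (- x)) = (LINT x:{..<0}|lborel. h x)"
    unfolding set_lebesgue_integral_def
    by (subst (2) lborel_integral_real_affine[where c = "-1" and t = 0])
       (auto intro!: Bochner_Integration.integral_cong simp: indicator_def)
  also have "(LINT x:{0<..}|lborel. h x) + (LINT x:{..<0}|lborel. h x) =
      (LINT x|lborel. indicator {0<..} x *\<^sub>R h x + indicator {..<0} x *\<^sub>R h x)"
    using 1 3 by (simp add: set_lebesgue_integral_def set_integrable_def)
  also have "\<dots> = (LINT x|lborel. h x)"
  proof (rule integral_cong_AE)
    have "AE x in lborel. x \<noteq> (0::real)" by (rule AE_lborel_singleton)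
    then show "AE x in lborel. indicator {0<..} x *\<^sub>R h x + indicator {..<0} x *\<^sub>R h x = h x"
      by eventually_elim (auto simp: indicator_def)
  qed measurable
  finally show "(LINT t|lborel. exp t *\<^sub>R (h (exp t) + h (- exp t))) = (LINT x|lborel. h x)" .
qed

text \<open>The factor exp (t / 2) is the Jacobian exp t of x = exp t times the weight
  \<bar>x\<bar>^(-1/2) of the Mellin kernel.\<close>

definition log_fold :: "(real \<Rightarrow> complex) \<Rightarrow> real \<Rightarrow> complex" where
  "log_fold f t = exp (t / 2) *\<^sub>R (f (exp t) + f (- exp t))"

lemma borel_measurable_log_fold [measurable]:
  assumes [measurable]: "f \<in> borel_measurable borel"
  shows "log_fold f \<in> borel_measurable borel"
  unfolding log_fold_def by measurable

section \<open>Absolutely convergent Mellin integrals\<close>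

definition mellin_integrable :: "(real \<Rightarrow> complex) \<Rightarrow> bool" where
  "mellin_integrable f \<longleftrightarrow> integrable lborel (\<lambda>x. (\<bar>x\<bar> powr (- 1 / 2)) *\<^sub>R f x)"

definition mellin_kernel :: "real \<Rightarrow> real \<Rightarrow> complex" where
  "mellin_kernel \<tau> x = complex_of_real \<bar>x\<bar> powr (- 1 / 2 + \<i> * complex_of_real \<tau>)"

lemma norm_mellin_kernel: "cmod (mellin_kernel \<tau> x) = \<bar>x\<bar> powr (- 1 / 2)"
  by (cases "x = 0") (simp_all add: mellin_kernel_def norm_powr_real_powr)

lemma borel_measurable_mellin_kernel [measurable]: "mellin_kernel \<tau> \<in> borel_measurable borel"
proof -
  have "mellin_kernel \<tau> =
    (\<lambda>x. if x = 0 then 0 else exp ((- 1 / 2 + \<i> * complex_of_real \<tau>) * of_real (ln \<bar>x\<bar>)))"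
    by (auto simp: mellin_kernel_def powr_def Ln_of_real fun_eq_iff)
  then show ?thesis by simp
qed

lemma mellin_kernel_exp: "mellin_kernel \<tau> (exp t) = of_real (exp (- t / 2)) * cis (\<tau> * t)"
proof -
  have "mellin_kernel \<tau> (exp t) = exp ((- 1 / 2 + \<i> * complex_of_real \<tau>) * of_real t)"
    by (simp add: mellin_kernel_def powr_def Ln_of_real)
  also have "\<dots> = of_real (exp (- t / 2)) * cis (\<tau> * t)"
    by (simp add: cis_conv_exp exp_add[symmetric] algebra_simps flip: exp_of_real)
  finally show ?thesis .
qed

lemma mellin_kernel_minus [simp]: "mellin_kernel \<tau> (- x) = mellin_kernel \<tau> x"
  by (simp add: mellin_kernel_def)

text \<open>The modulus of the kernel does not depend on \<tau>, so a single condition on f gives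
  absolute convergence for all \<tau>.\<close>

lemma mellin_kernel_integrable:
  assumes [measurable]: "f \<in> borel_measurable borel" and f: "mellin_integrable f"
  shows "integrable lborel (\<lambda>x. mellin_kernel \<tau> x * f x)"
  using f[unfolded mellin_integrable_def]
  by (rule Bochner_Integration.integrable_bound) (auto simp: norm_mult norm_mellin_kernel)

text \<open>The kernel is 0 at the origin because \<open>0 powr z = 0\<close>, so the restriction to
  \<open>- {0}\<close> disappears.\<close>

lemma mellin_integral_lebesgue: "mellin_integral f \<tau> = (LINT x|lebesgue. mellin_kernel \<tau> x * f x)"
  unfolding mellin_integral_def set_lebesgue_integral_def mellin_kernel_def
  by (rule Bochner_Integration.integral_cong) (auto simp: indicator_def)

lemma mellin_integral_lborel:
  assumes [measurable]: "f \<in> borel_measurable borel"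
  shows "mellin_integral f \<tau> = (LINT x|lborel. mellin_kernel \<tau> x * f x)"
  unfolding mellin_integral_lebesgue by (rule integral_completion) measurable

lemma mellin_integral_eq_fourier:
  assumes [measurable]: "f \<in> borel_measurable borel" and f: "mellin_integrable f"
  shows "mellin_integral f \<tau> = fourier (log_fold f) \<tau>"
proof -
  define h where "h \<tau> x = mellin_kernel \<tau> x * f x" for \<tau> x
  have ih: "integrable lborel (h \<tau>)" for \<tau>
    unfolding h_def by (rule mellin_kernel_integrable[OF assms])
  have eq: "exp t *\<^sub>R (h \<tau> (exp t) + h \<tau> (- exp t)) = log_fold f t * cis (\<tau> * t)" for \<tau> t
  proof -
    have "exp t * exp (- t / 2) = exp (t / 2)"
      by (simp add: exp_add[symmetric])
    then have e: "complex_of_real (exp t) * of_real (exp (- t / 2)) = of_real (exp (t / 2))"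
      by (metis of_real_mult)
    have "exp t *\<^sub>R (h \<tau> (exp t) + h \<tau> (- exp t)) =
       (complex_of_real (exp t) * of_real (exp (- t / 2))) * (f (exp t) + f (- exp t)) * cis (\<tau> * t)"
      by (simp add: h_def mellin_kernel_exp scaleR_conv_of_real algebra_simps)
    then show ?thesis by (simp only: e log_fold_def scaleR_conv_of_real)
  qed
  show "mellin_integral f \<tau> = fourier (log_fold f) \<tau>"
    using integral_exp_fold[OF ih[of \<tau>]]
    by (simp add: eq fourier_def mellin_integral_lborel h_def[symmetric])
qed

section \<open>Dilation correlations in logarithmic coordinates\<close>

lemma integrable_power2_dilate:
  fixes f :: "real \<Rightarrow> complex"
  assumes "integrable lborel (\<lambda>x. (cmod (f x))\<^sup>2)" "a \<noteq> 0"
  shows "integrable lborel (\<lambda>x. (cmod (f (a * x)))\<^sup>2)"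
  using lborel_integrable_real_affine[OF assms, of 0] by simp

lemma integrable_dilation_correlation:
  fixes f :: "real \<Rightarrow> complex"
  assumes [measurable]: "f \<in> borel_measurable borel"
    and f: "integrable lborel (\<lambda>x. (cmod (f x))\<^sup>2)" and "a \<noteq> 0"
  shows "integrable lborel (\<lambda>x. cnj (f x) * f (a * x))"
  using f integrable_power2_dilate[OF f \<open>a \<noteq> 0\<close>] by (intro integrable_mult_L2) auto

lemma dilation_correlation_lborel:
  assumes [measurable]: "f \<in> borel_measurable borel"
  shows "dilation_correlation f a = (LINT x|lborel. cnj (f x) * f (a * x))"
  unfolding dilation_correlation_def by (rule integral_completion) measurable

text \<open>Expanding the product gives four terms. Two pair points of equal sign and belong to the
  dilation by exp s; two pair points of opposite sign and belong to the dilation by - exp s. Folding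
  the two half-lines back together leaves exactly the sum of the two correlations.\<close>

lemma autocorrelation_log_fold:
  assumes [measurable]: "f \<in> borel_measurable borel"
    and f: "integrable lborel (\<lambda>x. (cmod (f x))\<^sup>2)"
  shows "autocorrelation (log_fold f) s =
    exp (s / 2) *\<^sub>R (dilation_correlation f (exp s) + dilation_correlation f (- exp s))"
proof -
  define h where "h x = cnj (f x) * f (exp s * x) + cnj (f x) * f (- exp s * x)" for x
  have i: "integrable lborel (\<lambda>x. cnj (f x) * f (a * x))" if "a \<noteq> 0" for a
    using that by (rule integrable_dilation_correlation[OF assms])
  have ih: "integrable lborel h"
    unfolding h_def by (intro Bochner_Integration.integrable_add i) auto
  have "cnj (log_fold f t) * log_fold f (t + s) =
      exp (s / 2) *\<^sub>R (exp t *\<^sub>R (h (exp t) + h (- exp t)))" for t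
  proof -
    have "exp (t / 2) * exp ((t + s) / 2) = exp (s / 2) * exp t"
      by (simp add: exp_add[symmetric] field_simps)
    then have e: "complex_of_real (exp (t / 2)) * of_real (exp ((t + s) / 2)) =
        of_real (exp (s / 2)) * of_real (exp t)"
      by (metis of_real_mult)
    have e': "exp (t + s) = exp s * exp t" by (simp add: exp_add)
    have "cnj (log_fold f t) * log_fold f (t + s) =
      (complex_of_real (exp (t / 2)) * of_real (exp ((t + s) / 2))) *
        (cnj (f (exp t) + f (- exp t)) * (f (exp (t + s)) + f (- exp (t + s))))"
      by (simp only: log_fold_def scaleR_conv_of_real complex_cnj_mult complex_cnj_complex_of_real mult_ac)
    also have "\<dots> = of_real (exp (s / 2)) * (of_real (exp t) * (h (exp t) + h (- exp t)))"
      unfolding e e' by (simp add: h_def algebra_simps)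
    finally show ?thesis by (simp only: scaleR_conv_of_real)
  qed
  then have "autocorrelation (log_fold f) s = exp (s / 2) *\<^sub>R (LINT x|lborel. h x)"
    unfolding autocorrelation_def using integral_exp_fold[OF ih] by (simp del: scaleR_scaleR)
  also have "(LINT x|lborel. h x) = dilation_correlation f (exp s) + dilation_correlation f (- exp s)"
    unfolding h_def dilation_correlation_lborel[OF assms(1)]
    by (intro Bochner_Integration.integral_add i) auto
  finally show ?thesis .
qed

section \<open>Bounded functions supported in an annulus\<close>

definition annular :: "(real \<Rightarrow> complex) \<Rightarrow> bool" where
  "annular f \<longleftrightarrow> (\<exists>N>0. \<forall>x. cmod (f x) \<le> N \<and> (f x \<noteq> 0 \<longrightarrow> 1 / N \<le> \<bar>x\<bar> \<and> \<bar>x\<bar> \<le> N))"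

lemma annular_diff:
  assumes "annular f" "annular g"
  shows "annular (\<lambda>x. f x - g x)"
proof -
  obtain N where N: "N > 0" "\<And>x. cmod (f x) \<le> N" "\<And>x. f x \<noteq> 0 \<Longrightarrow> 1 / N \<le> \<bar>x\<bar> \<and> \<bar>x\<bar> \<le> N"
    using assms(1) by (auto simp: annular_def)
  obtain K where K: "K > 0" "\<And>x. cmod (g x) \<le> K" "\<And>x. g x \<noteq> 0 \<Longrightarrow> 1 / K \<le> \<bar>x\<bar> \<and> \<bar>x\<bar> \<le> K"
    using assms(2) by (auto simp: annular_def)
  have le: "1 / (N + K) \<le> 1 / N" "1 / (N + K) \<le> 1 / K"
    using N(1) K(1) by (auto intro!: divide_left_mono)
  show ?thesis
    unfolding annular_def
  proof (intro exI[of _ "N + K"] conjI allI impI)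
    fix x
    show "cmod (f x - g x) \<le> N + K"
      using norm_triangle_ineq4[of "f x" "g x"] N(2)[of x] K(2)[of x] by linarith
    assume "f x - g x \<noteq> 0"
    then have "f x \<noteq> 0 \<or> g x \<noteq> 0" by auto
    then show "1 / (N + K) \<le> \<bar>x\<bar>" "\<bar>x\<bar> \<le> N + K"
      using N(1) K(1) N(3)[of x] K(3)[of x] le by linarith+
  qed (use N K in auto)
qed

text \<open>On annular functions every integral converges absolutely, and \<open>log_fold\<close>
  produces a bounded function of bounded support, so Plancherel is available for it.\<close>

lemma
  assumes [measurable]: "f \<in> borel_measurable borel" and "annular f"
  shows annular_mellin_integrable: "mellin_integrable f"
    and annular_L2: "integrable lborel (\<lambda>x. (cmod (f x))\<^sup>2)"
    and annular_Plancherel_integrable: "integrable lborel (\<lambda>\<tau>. (cmod (mellin_integral f \<tau>))\<^sup>2)"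
    and annular_Plancherel: "(LINT \<tau>|lborel. of_real ((cmod (mellin_integral f \<tau>))\<^sup>2) * cis (- (\<tau> * s))) =
      of_real (2 * pi * exp (s / 2)) * (dilation_correlation f (exp s) + dilation_correlation f (- exp s))"
    and annular_measurable_mellin: "mellin_integral f \<in> borel_measurable borel"
proof -
  obtain N where N: "N > 0" "\<And>x. cmod (f x) \<le> N" "\<And>x. f x \<noteq> 0 \<Longrightarrow> 1 / N \<le> \<bar>x\<bar> \<and> \<bar>x\<bar> \<le> N"
    using assms(2) by (auto simp: annular_def)
  have out: "f x = 0" if "N < \<bar>x\<bar>" for x using N(3)[of x] that by force
  have if1: "integrable lborel f"
    by (rule integrable_bounded_support[OF assms(1) N(2) out])
  show i2: "integrable lborel (\<lambda>x. (cmod (f x))\<^sup>2)"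
  proof (rule Bochner_Integration.integrable_bound)
    show "integrable lborel (\<lambda>x. N * cmod (f x))" using if1 by simp
    show "AE x in lborel. norm ((cmod (f x))\<^sup>2) \<le> norm (N * cmod (f x))"
      using N by (auto simp: power2_eq_square intro!: mult_right_mono)
  qed measurable
  show mi: "mellin_integrable f"
    unfolding mellin_integrable_def
  proof (rule Bochner_Integration.integrable_bound)
    show "integrable lborel (\<lambda>x. (1 / N) powr (- 1 / 2) * cmod (f x))" using if1 by simp
    show "AE x in lborel. norm (\<bar>x\<bar> powr (- 1 / 2) *\<^sub>R f x) \<le> norm ((1 / N) powr (- 1 / 2) * cmod (f x))"
    proof (rule AE_I2)
      fix x
      show "norm (\<bar>x\<bar> powr (- 1 / 2) *\<^sub>R f x) \<le> norm ((1 / N) powr (- 1 / 2) * cmod (f x))"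
      proof (cases "f x = 0")
        case False
        then have "\<bar>x\<bar> powr (- 1 / 2) \<le> (1 / N) powr (- 1 / 2)"
          using N by (intro powr_mono2') auto
        then show ?thesis by (simp add: abs_mult mult_right_mono)
      qed simp
    qed
  qed measurable
  \<comment> \<open>Where \<open>log_fold f t\<close> is nonzero, exp t lies between 1 / N and N.
    The absolute value of ln N also covers N < 1, where the annulus is empty.\<close>
  have bnd: "cmod (log_fold f t) \<le> exp (\<bar>ln N\<bar> / 2) * (2 * N)" for t
  proof (cases "f (exp t) = 0 \<and> f (- exp t) = 0")
    case False
    then have "exp t \<le> N" using N(3)[of "exp t"] N(3)[of "- exp t"] by auto
    then have "t \<le> ln N" using N(1) by (simp add: ln_ge_iff)
    then have "exp (t / 2) \<le> exp (\<bar>ln N\<bar> / 2)" by simp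
    moreover have "cmod (f (exp t) + f (- exp t)) \<le> 2 * N"
      using norm_triangle_ineq[of "f (exp t)" "f (- exp t)"] N(2)[of "exp t"] N(2)[of "- exp t"] by linarith
    ultimately show ?thesis by (simp add: log_fold_def mult_mono)
  qed (use N in \<open>simp add: log_fold_def\<close>)
  have supp: "log_fold f t = 0" if "\<bar>ln N\<bar> < \<bar>t\<bar>" for t
  proof -
    have "f (exp t) = 0 \<and> f (- exp t) = 0"
    proof (rule ccontr)
      assume "\<not> ?thesis"
      then have *: "1 / N \<le> exp t" "exp t \<le> N" using N(3)[of "exp t"] N(3)[of "- exp t"] by auto
      from *(2) have "t \<le> ln N" using N(1) by (simp add: ln_ge_iff)
      moreover from *(1) have "ln (1 / N) \<le> ln (exp t)" using N(1) by (subst ln_le_cancel_iff) auto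
      then have "- ln N \<le> t" using N(1) by (simp add: ln_div)
      ultimately show False using that by linarith
    qed
    then show ?thesis by (simp add: log_fold_def)
  qed
  have eq: "mellin_integral f \<tau> = fourier (log_fold f) \<tau>" for \<tau>
    by (rule mellin_integral_eq_fourier[OF assms(1) mi])
  show "mellin_integral f \<in> borel_measurable borel"
    unfolding eq[abs_def] by measurable
  have Lm: "log_fold f \<in> borel_measurable borel" by measurable
  show "integrable lborel (\<lambda>\<tau>. (cmod (mellin_integral f \<tau>))\<^sup>2)"
    unfolding eq by (rule Plancherel_bounded_support(1)[OF Lm bnd supp])
  show "(LINT \<tau>|lborel. of_real ((cmod (mellin_integral f \<tau>))\<^sup>2) * cis (- (\<tau> * s))) =
      of_real (2 * pi * exp (s / 2)) * (dilation_correlation f (exp s) + dilation_correlation f (- exp s))"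
    using Plancherel_bounded_support(2)[OF Lm bnd supp, where s = s]
    unfolding eq autocorrelation_log_fold[OF assms(1) i2]
    by (simp only: scaleR_conv_of_real of_real_mult mult.assoc)
qed

lemma dilation_correlation_1:
  assumes "f \<in> borel_measurable borel"
  shows "dilation_correlation f 1 = of_real (LINT x|lborel. (cmod (f x))\<^sup>2)"
proof -
  have "of_real ((cmod z)\<^sup>2) = cnj z * z" for z :: complex
    by (simp only: complex_norm_square mult.commute)
  then show ?thesis
    by (simp add: dilation_correlation_lborel[OF assms] del: of_real_power flip: integral_complex_of_real)
qed

lemma cmod_dilation_correlation_minus_1_le:
  assumes [measurable]: "f \<in> borel_measurable borel"
    and f: "integrable lborel (\<lambda>x. (cmod (f x))\<^sup>2)"
  shows "cmod (dilation_correlation f (- 1)) \<le> (LINT x|lborel. (cmod (f x))\<^sup>2)"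
proof -
  have f': "integrable lborel (\<lambda>x. (cmod (f (- x)))\<^sup>2)"
    using integrable_power2_dilate[OF f, of "-1"] by simp
  have "cmod (dilation_correlation f (- 1)) \<le> (LINT x|lborel. cmod (cnj (f x) * f (- x)))"
    unfolding dilation_correlation_lborel[OF assms(1)] by simp
  also have "\<dots> \<le> sqrt (LINT x|lborel. (cmod (f x))\<^sup>2) * sqrt (LINT x|lborel. (cmod (f (- x)))\<^sup>2)"
    using Cauchy_Schwarz_L2[OF _ _ f f'] by (simp add: norm_mult)
  also have "(LINT x|lborel. (cmod (f (- x)))\<^sup>2) = (LINT x|lborel. (cmod (f x))\<^sup>2)"
    using lborel_integral_real_affine[of "-1" "\<lambda>x. (cmod (f x))\<^sup>2" 0] by simp
  finally show ?thesis by simp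
qed

text \<open>Plancherel at s = 0 gives 2 pi times the sum of the correlations at 1 and -1. The first
  is the squared norm and the second is at most that by Cauchy-Schwarz, whence 4 pi.\<close>

lemma annular_mellin_bound:
  assumes [measurable]: "f \<in> borel_measurable borel" and "annular f"
  shows "(LINT \<tau>|lborel. (cmod (mellin_integral f \<tau>))\<^sup>2) \<le> 4 * pi * (LINT x|lborel. (cmod (f x))\<^sup>2)"
proof -
  note f2 = annular_L2[OF assms]
  have "(LINT \<tau>|lborel. (cmod (mellin_integral f \<tau>))\<^sup>2) = cmod (LINT \<tau>|lborel. of_real ((cmod (mellin_integral f \<tau>))\<^sup>2))"
    by (simp only: integral_complex_of_real norm_of_real) simp
  also have "\<dots> = cmod (of_real (2 * pi) * (dilation_correlation f 1 + dilation_correlation f (- 1)))"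
    using annular_Plancherel[OF assms, of 0] by simp
  also have "\<dots> = 2 * pi * cmod (dilation_correlation f 1 + dilation_correlation f (- 1))"
    by (simp add: norm_mult)
  also have "\<dots> \<le> 2 * pi * (cmod (dilation_correlation f 1) + cmod (dilation_correlation f (- 1)))"
    by (intro mult_left_mono norm_triangle_ineq) auto
  also have "\<dots> \<le> 2 * pi * ((LINT x|lborel. (cmod (f x))\<^sup>2) + (LINT x|lborel. (cmod (f x))\<^sup>2))"
    using cmod_dilation_correlation_minus_1_le[OF assms(1) f2]
    by (intro mult_left_mono add_mono) (auto simp: dilation_correlation_1[OF assms(1)])
  finally show ?thesis by simp
qed

lemma mellin_integral_diff:
  assumes [measurable]: "f \<in> borel_measurable borel" "g \<in> borel_measurable borel"
    and "mellin_integrable f" "mellin_integrable g"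
  shows "mellin_integral (\<lambda>x. f x - g x) \<tau> = mellin_integral f \<tau> - mellin_integral g \<tau>"
  using assms by (simp add: mellin_integral_lborel mellin_kernel_integrable right_diff_distrib)

section \<open>Approximation by annular truncations\<close>

definition annular_trunc :: "nat \<Rightarrow> (real \<Rightarrow> complex) \<Rightarrow> real \<Rightarrow> complex" where
  "annular_trunc N f x =
    (if 1 / real (Suc N) \<le> \<bar>x\<bar> \<and> \<bar>x\<bar> \<le> real (Suc N) \<and> cmod (f x) \<le> real (Suc N) then f x else 0)"

lemma borel_measurable_annular_trunc [measurable]:
  assumes [measurable]: "f \<in> borel_measurable borel"
  shows "annular_trunc N f \<in> borel_measurable borel"
  unfolding annular_trunc_def by measurable

lemma annular_annular_trunc: "annular (annular_trunc N f)"
  unfolding annular_def annular_trunc_def by (intro exI[of _ "real (Suc N)"]) auto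

lemma cmod_annular_trunc_le: "cmod (annular_trunc N f x) \<le> cmod (f x)"
  by (simp add: annular_trunc_def)

text \<open>The truncation cuts values as well as the domain, since an L2 function may be unbounded
  on an annulus. At a fixed nonzero point all three conditions hold from some index on, so the
  sequence is eventually constant.\<close>

lemma annular_trunc_tendsto:
  assumes "x \<noteq> 0"
  shows "(\<lambda>N. annular_trunc N f x) \<longlonglongrightarrow> f x"
proof (rule tendsto_eventually)
  obtain n1 where n1: "inverse (real (Suc n1)) < \<bar>x\<bar>"
    using reals_Archimedean[of "\<bar>x\<bar>"] assms by auto
  obtain n2 where n2: "\<bar>x\<bar> + cmod (f x) \<le> real n2" using real_arch_simple by blast
  show "\<forall>\<^sub>F N in sequentially. annular_trunc N f x = f x"
    using eventually_ge_at_top[of "max n1 n2"]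
  proof eventually_elim
    case (elim N)
    have "inverse (real (Suc N)) \<le> inverse (real (Suc n1))" using elim by (intro le_imp_inverse_le) auto
    then have "1 / real (Suc N) \<le> \<bar>x\<bar>" using n1 by (simp add: inverse_eq_divide)
    moreover have "real n2 \<le> real (Suc N)" using elim by simp
    then have "\<bar>x\<bar> \<le> real (Suc N)" "cmod (f x) \<le> real (Suc N)"
      using n2 norm_ge_zero[of "f x"] abs_ge_zero[of x] by linarith+
    ultimately show ?case unfolding annular_trunc_def by simp
  qed
qed

lemma annular_trunc_L2_tendsto:
  assumes [measurable]: "f \<in> borel_measurable borel"
    and f: "integrable lborel (\<lambda>x. (cmod (f x))\<^sup>2)"
  shows "(\<lambda>N. LINT x|lborel. (cmod (annular_trunc N f x - f x))\<^sup>2) \<longlonglongrightarrow> 0"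
proof -
  have "(\<lambda>N. LINT x|lborel. (cmod (annular_trunc N f x - f x))\<^sup>2) \<longlonglongrightarrow> (LINT x|(lborel::real measure). 0)"
  proof (rule integral_dominated_convergence[OF _ _ f])
    show "AE x in lborel. (\<lambda>N. (cmod (annular_trunc N f x - f x))\<^sup>2) \<longlonglongrightarrow> 0"
      using AE_lborel_singleton[of 0]
    proof eventually_elim
      case (elim x)
      have "(\<lambda>N. (cmod (annular_trunc N f x - f x))\<^sup>2) \<longlonglongrightarrow> (cmod (f x - f x))\<^sup>2"
        by (intro tendsto_intros annular_trunc_tendsto elim)
      then show ?case by simp
    qed
    show "AE x in lborel. norm ((cmod (annular_trunc N f x - f x))\<^sup>2) \<le> (cmod (f x))\<^sup>2" for N
      by (auto simp: annular_trunc_def)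
  qed measurable
  then show ?thesis by simp
qed

lemma annular_trunc_mellin_tendsto:
  assumes [measurable]: "f \<in> borel_measurable borel" and f: "mellin_integrable f"
  shows "(\<lambda>N. mellin_integral (annular_trunc N f) \<tau>) \<longlonglongrightarrow> mellin_integral f \<tau>"
  unfolding mellin_integral_lborel[OF borel_measurable_annular_trunc[OF assms(1)]]
    mellin_integral_lborel[OF assms(1)]
proof (rule integral_dominated_convergence)
  show "integrable lborel (\<lambda>x. cmod (mellin_kernel \<tau> x * f x))"
    using mellin_kernel_integrable[OF assms] by (rule integrable_norm)
  show "AE x in lborel. (\<lambda>N. mellin_kernel \<tau> x * annular_trunc N f x) \<longlonglongrightarrow> mellin_kernel \<tau> x * f x"
    using AE_lborel_singleton[of 0] by eventually_elim (intro tendsto_mult tendsto_const annular_trunc_tendsto)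
  show "AE x in lborel. cmod (mellin_kernel \<tau> x * annular_trunc N f x) \<le> cmod (mellin_kernel \<tau> x * f x)" for N
    by (auto simp: norm_mult cmod_annular_trunc_le intro!: mult_left_mono)
qed measurable

lemma annular_trunc_correlation_tendsto:
  assumes [measurable]: "f \<in> borel_measurable borel"
    and f: "integrable lborel (\<lambda>x. (cmod (f x))\<^sup>2)" and "a \<noteq> 0"
  shows "(\<lambda>N. dilation_correlation (annular_trunc N f) a) \<longlonglongrightarrow> dilation_correlation f a"
  unfolding dilation_correlation_lborel[OF borel_measurable_annular_trunc[OF assms(1)]]
    dilation_correlation_lborel[OF assms(1)]
proof (rule integral_dominated_convergence)
  show "integrable lborel (\<lambda>x. cmod (cnj (f x) * f (a * x)))"
    using integrable_dilation_correlation[OF assms] by (rule integrable_norm)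
  show "AE x in lborel. (\<lambda>N. cnj (annular_trunc N f x) * annular_trunc N f (a * x)) \<longlonglongrightarrow> cnj (f x) * f (a * x)"
    using AE_lborel_singleton[of 0]
    by eventually_elim (use \<open>a \<noteq> 0\<close> in \<open>auto intro!: tendsto_mult tendsto_cnj annular_trunc_tendsto\<close>)
  show "AE x in lborel. cmod (cnj (annular_trunc N f x) * annular_trunc N f (a * x)) \<le> cmod (cnj (f x) * f (a * x))" for N
    by (auto simp: norm_mult cmod_annular_trunc_le intro!: mult_mono)
qed measurable

section \<open>The Mellin transform on square-integrable functions\<close>

text \<open>A relation between Borel representatives, because m is fixed only up to null sets. It
  describes the transform by one explicit approximating sequence and so can be handled before any
  extension operator is known to exist.\<close>

definition mellin_L2 :: "(real \<Rightarrow> complex) \<Rightarrow> (real \<Rightarrow> complex) \<Rightarrow> bool" where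
  "mellin_L2 f m \<longleftrightarrow> f \<in> borel_measurable borel \<and> integrable lborel (\<lambda>x. (cmod (f x))\<^sup>2) \<and>
    m \<in> borel_measurable borel \<and> integrable lborel (\<lambda>\<tau>. (cmod (m \<tau>))\<^sup>2) \<and>
    (\<lambda>N. LINT \<tau>|lborel. (cmod (mellin_integral (annular_trunc N f) \<tau> - m \<tau>))\<^sup>2) \<longlonglongrightarrow> 0"

lemma annular_trunc_L2:
  assumes "f \<in> borel_measurable borel"
  shows "integrable lborel (\<lambda>x. (cmod (annular_trunc N f x))\<^sup>2)"
  by (rule annular_L2[OF borel_measurable_annular_trunc[OF assms] annular_annular_trunc])

lemma
  assumes "f \<in> borel_measurable borel"
  shows measurable_mellin_annular_trunc: "mellin_integral (annular_trunc N f) \<in> borel_measurable borel"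
    and integrable_mellin_annular_trunc:
      "integrable lborel (\<lambda>\<tau>. (cmod (mellin_integral (annular_trunc N f) \<tau>))\<^sup>2)"
  using annular_measurable_mellin annular_Plancherel_integrable
    borel_measurable_annular_trunc[OF assms] annular_annular_trunc by blast+

text \<open>Stated for two functions and two indices: equal functions give the Cauchy property of
  the truncated transforms, equal indices give continuity in f.\<close>

lemma mellin_annular_trunc_dist_le:
  assumes "f \<in> borel_measurable borel" "g \<in> borel_measurable borel"
  shows "(LINT \<tau>|lborel. (cmod (mellin_integral (annular_trunc i f) \<tau> - mellin_integral (annular_trunc j g) \<tau>))\<^sup>2)
    \<le> 4 * pi * (LINT x|lborel. (cmod (annular_trunc i f x - annular_trunc j g x))\<^sup>2)"
proof -
  note m = borel_measurable_annular_trunc[OF assms(1), of i] borel_measurable_annular_trunc[OF assms(2), of j]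
  note mi = annular_mellin_integrable[OF m(1) annular_annular_trunc] annular_mellin_integrable[OF m(2) annular_annular_trunc]
  show ?thesis
    unfolding mellin_integral_diff[OF m mi, symmetric]
    by (intro annular_mellin_bound annular_diff annular_annular_trunc borel_measurable_diff m)
qed

lemma L2_dist_commute:
  fixes f g :: "'a \<Rightarrow> complex"
  shows "(LINT x|M. (cmod (f x - g x))\<^sup>2) = (LINT x|M. (cmod (g x - f x))\<^sup>2)"
  by (simp add: norm_minus_commute)

lemma mellin_L2_exists:
  assumes fm [measurable]: "f \<in> borel_measurable borel"
    and f: "integrable lborel (\<lambda>x. (cmod (f x))\<^sup>2)"
  shows "\<exists>m. mellin_L2 f m"
proof -
  define t where "t N = annular_trunc N f" for N
  have tm [measurable]: "t N \<in> borel_measurable borel" for N unfolding t_def by measurable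
  have ti: "integrable lborel (\<lambda>x. (cmod (t N x))\<^sup>2)" for N
    unfolding t_def by (rule annular_trunc_L2[OF fm])
  have "\<exists>h\<in>borel_measurable lborel. integrable lborel (\<lambda>x. (cmod (h x))\<^sup>2) \<and>
      (\<lambda>N. LINT \<tau>|lborel. (cmod (mellin_integral (t N) \<tau> - h \<tau>))\<^sup>2) \<longlonglongrightarrow> 0"
  proof (rule Riesz_Fischer_L2)
    show "sigma_finite_measure (lborel :: real measure)" by (rule sigma_finite_lborel)
    show "mellin_integral (t N) \<in> borel_measurable lborel" for N
      using measurable_mellin_annular_trunc[OF fm] by (simp add: t_def)
    show "integrable lborel (\<lambda>\<tau>. (cmod (mellin_integral (t N) \<tau>))\<^sup>2)" for N
      unfolding t_def by (rule integrable_mellin_annular_trunc[OF fm])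
    fix e :: real assume "e > 0"
    \<comment> \<open>16 pi is 4 pi from the Mellin bound times 2 + 2 from the triangle
      inequality.\<close>
    then have "e / (16 * pi) > 0" by simp
    from order_tendstoD(2)[OF annular_trunc_L2_tendsto[OF assms] this]
    obtain N where N: "\<And>n. n \<ge> N \<Longrightarrow> (LINT x|lborel. (cmod (t n x - f x))\<^sup>2) < e / (16 * pi)"
      by (auto simp: eventually_sequentially t_def)
    have "(LINT \<tau>|lborel. (cmod (mellin_integral (t i) \<tau> - mellin_integral (t j) \<tau>))\<^sup>2) < e"
      if "i \<ge> N" "j \<ge> N" for i j
    proof -
      have "(LINT x|lborel. (cmod (t i x - t j x))\<^sup>2) \<le>
          2 * (LINT x|lborel. (cmod (t i x - f x))\<^sup>2) + 2 * (LINT x|lborel. (cmod (t j x - f x))\<^sup>2)"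
        using L2_triangle[of "t i" lborel f "t j"] f ti L2_dist_commute[of lborel f "t j"] by simp
      also have "\<dots> < 2 * (e / (16 * pi)) + 2 * (e / (16 * pi))"
        using N[OF that(1)] N[OF that(2)] by simp
      finally have "4 * pi * (LINT x|lborel. (cmod (t i x - t j x))\<^sup>2) < 4 * pi * (2 * (e / (16 * pi)) + 2 * (e / (16 * pi)))"
        by (intro mult_strict_left_mono) auto
      also have "\<dots> = e" by (simp add: field_simps)
      finally show ?thesis
        using mellin_annular_trunc_dist_le[OF fm fm, of i j] by (simp add: t_def)
    qed
    then show "\<exists>N. \<forall>i\<ge>N. \<forall>j\<ge>N. (LINT \<tau>|lborel. (cmod (mellin_integral (t i) \<tau> - mellin_integral (t j) \<tau>))\<^sup>2) < e"
      by blast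
  qed
  then show ?thesis using assms by (auto simp: mellin_L2_def t_def)
qed

text \<open>This is Lipschitz continuity in terms of squared distances; any constant would serve.
  Here two triangle inequalities on the transform side give 4, the annular bound gives 4 pi, and two
  more on the function side give another 4.\<close>

lemma mellin_L2_dist_le:
  assumes f: "mellin_L2 f m" and g: "mellin_L2 g k"
  shows "(LINT \<tau>|lborel. (cmod (m \<tau> - k \<tau>))\<^sup>2) \<le> 64 * pi * (LINT x|lborel. (cmod (f x - g x))\<^sup>2)"
proof -
  define mf where "mf N = mellin_integral (annular_trunc N f)" for N
  define mg where "mg N = mellin_integral (annular_trunc N g)" for N
  define tf where "tf N = annular_trunc N f" for N
  define tg where "tg N = annular_trunc N g" for N
  have fm [measurable]: "f \<in> borel_measurable borel" and gm [measurable]: "g \<in> borel_measurable borel"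
    and mm [measurable]: "m \<in> borel_measurable borel" and km [measurable]: "k \<in> borel_measurable borel"
    and i: "integrable lborel (\<lambda>x. (cmod (f x))\<^sup>2)" "integrable lborel (\<lambda>x. (cmod (g x))\<^sup>2)"
      "integrable lborel (\<lambda>x. (cmod (m x))\<^sup>2)" "integrable lborel (\<lambda>x. (cmod (k x))\<^sup>2)"
    and lm: "(\<lambda>N. LINT \<tau>|lborel. (cmod (mf N \<tau> - m \<tau>))\<^sup>2) \<longlonglongrightarrow> 0"
    and lk: "(\<lambda>N. LINT \<tau>|lborel. (cmod (mg N \<tau> - k \<tau>))\<^sup>2) \<longlonglongrightarrow> 0"
    using f g by (auto simp: mellin_L2_def mf_def mg_def)
  have [measurable]: "mf N \<in> borel_measurable borel" "mg N \<in> borel_measurable borel"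
      "tf N \<in> borel_measurable borel" "tg N \<in> borel_measurable borel" for N
    unfolding mf_def mg_def tf_def tg_def
    by (auto intro: measurable_mellin_annular_trunc[OF fm] measurable_mellin_annular_trunc[OF gm])
  have j: "integrable lborel (\<lambda>x. (cmod (mf N x))\<^sup>2)" "integrable lborel (\<lambda>x. (cmod (mg N x))\<^sup>2)"
      "integrable lborel (\<lambda>x. (cmod (tf N x))\<^sup>2)" "integrable lborel (\<lambda>x. (cmod (tg N x))\<^sup>2)" for N
    unfolding mf_def mg_def tf_def tg_def
    by (auto intro: integrable_mellin_annular_trunc annular_trunc_L2 fm gm)
  have lf: "(\<lambda>N. LINT x|lborel. (cmod (tf N x - f x))\<^sup>2) \<longlonglongrightarrow> 0"
    and lg: "(\<lambda>N. LINT x|lborel. (cmod (tg N x - g x))\<^sup>2) \<longlonglongrightarrow> 0"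
    unfolding tf_def tg_def using annular_trunc_L2_tendsto fm gm i by auto
  define D where "D = (LINT x|lborel. (cmod (f x - g x))\<^sup>2)"
  have bound: "(LINT \<tau>|lborel. (cmod (m \<tau> - k \<tau>))\<^sup>2) \<le>
      2 * (LINT \<tau>|lborel. (cmod (mf N \<tau> - m \<tau>))\<^sup>2) + 4 * (LINT \<tau>|lborel. (cmod (mg N \<tau> - k \<tau>))\<^sup>2)
      + 16 * pi * (2 * (LINT x|lborel. (cmod (tf N x - f x))\<^sup>2) + 4 * D + 4 * (LINT x|lborel. (cmod (tg N x - g x))\<^sup>2))" for N
  proof -
    have 1: "(LINT \<tau>|lborel. (cmod (m \<tau> - k \<tau>))\<^sup>2) \<le>
        2 * (LINT \<tau>|lborel. (cmod (mf N \<tau> - m \<tau>))\<^sup>2) + 2 * (LINT \<tau>|lborel. (cmod (mf N \<tau> - k \<tau>))\<^sup>2)"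
      using L2_triangle[of m lborel "mf N" k] i j L2_dist_commute[of lborel m "mf N"] by simp
    have 2: "(LINT \<tau>|lborel. (cmod (mf N \<tau> - k \<tau>))\<^sup>2) \<le>
        2 * (LINT \<tau>|lborel. (cmod (mf N \<tau> - mg N \<tau>))\<^sup>2) + 2 * (LINT \<tau>|lborel. (cmod (mg N \<tau> - k \<tau>))\<^sup>2)"
      using L2_triangle[of "mf N" lborel "mg N" k] i j by simp
    have 3: "(LINT \<tau>|lborel. (cmod (mf N \<tau> - mg N \<tau>))\<^sup>2) \<le> 4 * pi * (LINT x|lborel. (cmod (tf N x - tg N x))\<^sup>2)"
      unfolding mf_def mg_def tf_def tg_def by (rule mellin_annular_trunc_dist_le[OF fm gm])
    have 4: "(LINT x|lborel. (cmod (tf N x - tg N x))\<^sup>2) \<le>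
        2 * (LINT x|lborel. (cmod (tf N x - f x))\<^sup>2) + 2 * (LINT x|lborel. (cmod (f x - tg N x))\<^sup>2)"
      using L2_triangle[of "tf N" lborel f "tg N"] i j by simp
    have 5: "(LINT x|lborel. (cmod (f x - tg N x))\<^sup>2) \<le>
        2 * D + 2 * (LINT x|lborel. (cmod (tg N x - g x))\<^sup>2)"
      using L2_triangle[of f lborel g "tg N"] i j L2_dist_commute[of lborel g "tg N"] by (simp add: D_def)
    have "(LINT x|lborel. (cmod (tf N x - tg N x))\<^sup>2) \<le>
       2 * (LINT x|lborel. (cmod (tf N x - f x))\<^sup>2) + 4 * D + 4 * (LINT x|lborel. (cmod (tg N x - g x))\<^sup>2)"
      using 4 5 by linarith
    then have "4 * pi * (LINT x|lborel. (cmod (tf N x - tg N x))\<^sup>2) \<le> 4 * pi *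
       (2 * (LINT x|lborel. (cmod (tf N x - f x))\<^sup>2) + 4 * D + 4 * (LINT x|lborel. (cmod (tg N x - g x))\<^sup>2))"
      by (intro mult_left_mono) auto
    with 1 2 3 show ?thesis by linarith
  qed
  have "(\<lambda>N. 2 * (LINT \<tau>|lborel. (cmod (mf N \<tau> - m \<tau>))\<^sup>2) + 4 * (LINT \<tau>|lborel. (cmod (mg N \<tau> - k \<tau>))\<^sup>2)
      + 16 * pi * (2 * (LINT x|lborel. (cmod (tf N x - f x))\<^sup>2) + 4 * D + 4 * (LINT x|lborel. (cmod (tg N x - g x))\<^sup>2)))
      \<longlonglongrightarrow> 2 * 0 + 4 * 0 + 16 * pi * (2 * 0 + 4 * D + 4 * 0)"
    by (intro tendsto_add tendsto_mult tendsto_const lm lk lf lg)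
  then have "(LINT \<tau>|lborel. (cmod (m \<tau> - k \<tau>))\<^sup>2) \<le> 2 * 0 + 4 * 0 + 16 * pi * (2 * 0 + 4 * D + 4 * 0)"
    using bound by (intro LIMSEQ_le_const) blast+
  then show ?thesis by (simp add: D_def)
qed

text \<open>The truncated transforms converge to m in L2 and, by dominated convergence, to the
  integral at every point; the two limits must agree almost everywhere.\<close>

lemma mellin_L2_eq_mellin_integral:
  assumes f: "mellin_L2 f m" and mi: "mellin_integrable f"
  shows "AE \<tau> in lborel. m \<tau> = mellin_integral f \<tau>"
proof -
  have fm [measurable]: "f \<in> borel_measurable borel" and mm [measurable]: "m \<in> borel_measurable borel"
    and m2: "integrable lborel (\<lambda>x. (cmod (m x))\<^sup>2)"
    and lim: "(\<lambda>N. LINT \<tau>|lborel. (cmod (mellin_integral (annular_trunc N f) \<tau> - m \<tau>))\<^sup>2) \<longlonglongrightarrow> 0"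
    using f by (auto simp: mellin_L2_def)
  have "AE \<tau> in lborel. mellin_integral f \<tau> = m \<tau>"
  proof (rule L2_tendsto_AE_unique[OF _ _ _ _ lim])
    show "mellin_integral (annular_trunc N f) \<in> borel_measurable lborel" for N
      using measurable_mellin_annular_trunc[OF fm] by simp
    show "mellin_integral f \<in> borel_measurable lborel"
      unfolding mellin_integral_eq_fourier[OF fm mi, abs_def] by simp
    show "integrable lborel (\<lambda>\<tau>. (cmod (mellin_integral (annular_trunc N f) \<tau> - m \<tau>))\<^sup>2)" for N
      using measurable_mellin_annular_trunc[OF fm]
      by (intro integrable_diff_L2 integrable_mellin_annular_trunc fm m2) auto
    show "AE \<tau> in lborel. (\<lambda>N. mellin_integral (annular_trunc N f) \<tau>) \<longlonglongrightarrow> mellin_integral f \<tau>"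
      by (intro AE_I2 annular_trunc_mellin_tendsto fm mi)
  qed simp
  then show ?thesis by eventually_elim simp
qed

text \<open>The identity for truncations passes to the limit: L2 convergence handles the left side,
  and dominated convergence of the correlations the right side.\<close>

theorem mellin_L2_Plancherel:
  assumes "mellin_L2 f m"
  shows "(LINT \<tau>|lborel. of_real ((cmod (m \<tau>))\<^sup>2) * cis (- (\<tau> * s))) =
      of_real (2 * pi * exp (s / 2)) * (dilation_correlation f (exp s) + dilation_correlation f (- exp s))"
proof -
  have fm [measurable]: "f \<in> borel_measurable borel" and mm [measurable]: "m \<in> borel_measurable borel"
    and f2: "integrable lborel (\<lambda>x. (cmod (f x))\<^sup>2)"
    and m2: "integrable lborel (\<lambda>x. (cmod (m x))\<^sup>2)"
    and lim: "(\<lambda>N. LINT \<tau>|lborel. (cmod (mellin_integral (annular_trunc N f) \<tau> - m \<tau>))\<^sup>2) \<longlonglongrightarrow> 0"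
    using assms by (auto simp: mellin_L2_def)
  have "(\<lambda>N. LINT \<tau>|lborel. of_real ((cmod (mellin_integral (annular_trunc N f) \<tau>))\<^sup>2) * cis (- (\<tau> * s)))
      \<longlonglongrightarrow> (LINT \<tau>|lborel. of_real ((cmod (m \<tau>))\<^sup>2) * cis (- (\<tau> * s)))"
    using measurable_mellin_annular_trunc[OF fm]
    by (intro L2_tendsto_imp_tendsto_integral_norm_power2 integrable_mellin_annular_trunc fm m2 lim) auto
  moreover have "(\<lambda>N. LINT \<tau>|lborel. of_real ((cmod (mellin_integral (annular_trunc N f) \<tau>))\<^sup>2) * cis (- (\<tau> * s)))
      \<longlonglongrightarrow> of_real (2 * pi * exp (s / 2)) * (dilation_correlation f (exp s) + dilation_correlation f (- exp s))"
    unfolding annular_Plancherel[OF borel_measurable_annular_trunc[OF fm] annular_annular_trunc]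
    by (intro tendsto_mult tendsto_add tendsto_const annular_trunc_correlation_tendsto fm f2) auto
  ultimately show ?thesis by (rule LIMSEQ_unique)
qed

section \<open>The Gaussian\<close>

lemma has_bochner_integral_gaussian:
  assumes c: "c > 0"
  shows "has_bochner_integral lborel (\<lambda>x. exp (- (c * x\<^sup>2))) (sqrt (pi / c))"
proof -
  define k where "k = sqrt (2 * c)"
  have k: "k > 0" "k\<^sup>2 = 2 * c" using c by (simp_all add: k_def)
  have "exp (- (c * x\<^sup>2)) = sqrt (2 * pi) * std_normal_density (0 + k * x)" for x
    by (simp add: std_normal_density_def power_mult_distrib k)
  moreover have "has_bochner_integral lborel (\<lambda>x. sqrt (2 * pi) * std_normal_density (0 + k * x)) (sqrt (2 * pi) * (1 / k))"
  proof (rule has_bochner_integral_mult_right)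
    have "integrable lborel (\<lambda>x. std_normal_density (0 + k * x))"
      by (rule integrable_std_normal_density_affine) (use k in simp)
    moreover have "(LINT x|lborel. std_normal_density (0 + k * x)) = 1 / k"
      using lborel_integral_real_affine[of k std_normal_density 0] k by (simp add: field_simps)
    ultimately show "has_bochner_integral lborel (\<lambda>x. std_normal_density (0 + k * x)) (1 / k)"
      by (simp add: has_bochner_integral_iff)
  qed
  moreover have "sqrt (2 * pi) * (1 / k) = sqrt (pi / c)"
    by (simp add: k_def real_sqrt_mult real_sqrt_divide)
  ultimately show ?thesis by simp
qed

text \<open>Euler's integral under x = exp v, the shape in which the transform of the Gaussian
  arises in logarithmic coordinates.\<close>

lemma has_bochner_integral_Gamma_exp:
  assumes z: "Re z > 0"
  shows "has_bochner_integral lborel (\<lambda>v. exp (z * of_real v) * of_real (exp (- exp v))) (Gamma z)"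
proof -
  \<comment> \<open>The power is written with exp and ln and cut off at 0, so that Borel
    measurability is immediate.\<close>
  define h where "h x = (if x > 0 then exp ((z - 1) * of_real (ln x)) / of_real (exp x) else 0)" for x :: real
  have [measurable]: "h \<in> borel_measurable borel" unfolding h_def by measurable
  have h_eq: "h x = of_real x powr (z - 1) / of_real (exp x)" if "x \<in> {0<..}" for x
    using that by (simp add: h_def powr_def Ln_of_real)
  have eq: "exp v *\<^sub>R h (exp v) = exp (z * of_real v) * of_real (exp (- exp v))" for v
  proof -
    have "exp v *\<^sub>R h (exp v) = exp (of_real v) * exp ((z - 1) * of_real v) / of_real (exp (exp v))"
      by (simp add: h_def scaleR_conv_of_real exp_of_real)
    also have "exp (of_real v) * exp ((z - 1) * of_real v) = exp (z * of_real v)"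
      by (simp add: exp_add[symmetric] algebra_simps)
    finally show ?thesis by (simp add: exp_minus divide_inverse)
  qed
  have abs: "h absolutely_integrable_on {0<..}"
    using absolutely_integrable_Gamma_integral'[OF z] h_eq
    by (subst set_integrable_cong[OF refl refl h_eq]) auto
  have set: "set_integrable lborel {0<..} h"
    using abs unfolding set_integrable_def by (subst (asm) integrable_completion) auto
  have "(LINT x:{0<..}|lborel. h x) = (LINT x:{0<..}|lebesgue. h x)"
    unfolding set_lebesgue_integral_def by (rule integral_completion[symmetric]) measurable
  also have "\<dots> = integral {0<..} h" by (rule set_lebesgue_integral_eq_integral(2)[OF abs])
  also have "\<dots> = integral {0<..} (\<lambda>x. of_real x powr (z - 1) / of_real (exp x))"
    by (intro Henstock_Kurzweil_Integration.integral_cong h_eq)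
  also have "\<dots> = Gamma z" by (rule integral_unique[OF Gamma_integral_complex'[OF z]])
  finally show ?thesis
    using set integral_exp_substitution[of h] integrable_exp_substitution[of h]
    by (simp add: has_bochner_integral_iff eq)
qed

definition gaussian :: "real \<Rightarrow> complex" where
  "gaussian x = of_real (exp (- x\<^sup>2))"

lemma borel_measurable_gaussian [measurable]: "gaussian \<in> borel_measurable borel"
  unfolding gaussian_def by measurable

lemma gaussian_L2: "integrable lborel (\<lambda>x. (cmod (gaussian x))\<^sup>2)"
proof -
  have "(cmod (gaussian x))\<^sup>2 = exp (- (2 * x\<^sup>2))" for x
    by (simp add: gaussian_def power2_eq_square exp_add[symmetric])
  then show ?thesis
    using has_bochner_integral_gaussian[of 2] by (simp add: has_bochner_integral_iff)
qed

lemma dilation_correlation_gaussian: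
  "dilation_correlation gaussian a = of_real (sqrt pi * (1 + a\<^sup>2) powr (- 1 / 2))"
proof -
  have pos: "1 + a\<^sup>2 > 0" by (simp add: add_pos_nonneg)
  have "cnj (gaussian x) * gaussian (a * x) = of_real (exp (- ((1 + a\<^sup>2) * x\<^sup>2)))" for x
    by (simp add: gaussian_def power_mult_distrib algebra_simps flip: of_real_mult exp_add)
  then have "dilation_correlation gaussian a = of_real (LINT x|lborel. exp (- ((1 + a\<^sup>2) * x\<^sup>2)))"
    by (simp add: dilation_correlation_lborel)
  also have "(LINT x|lborel. exp (- ((1 + a\<^sup>2) * x\<^sup>2))) = sqrt (pi / (1 + a\<^sup>2))"
    using has_bochner_integral_gaussian[OF pos] by (rule has_bochner_integral_integral_eq)
  also have "\<dots> = sqrt pi * (1 + a\<^sup>2) powr (- 1 / 2)"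
  proof -
    have "(1 + a\<^sup>2) powr (- 1 / 2) = inverse (sqrt (1 + a\<^sup>2))"
      using powr_minus[of "1 + a\<^sup>2" "1 / 2"] powr_half_sqrt[of "1 + a\<^sup>2"] pos by simp
    then show ?thesis by (simp only: real_sqrt_divide divide_inverse[of "sqrt pi"])
  qed
  finally show ?thesis .
qed

lemma
  shows gaussian_mellin_integrable: "mellin_integrable gaussian"
    and mellin_integral_gaussian: "mellin_integral gaussian \<tau> = Gamma (1 / 4 + \<i> / 2 * complex_of_real \<tau>)"
proof -
  define z where "z \<tau> = 1 / 4 + \<i> / 2 * complex_of_real \<tau>" for \<tau>
  have z: "Re (z \<tau>) > 0" for \<tau> by (simp add: z_def)
  \<comment> \<open>The substitution is v = 2 t, as x^2 = exp (2 t); then (1/2 + i \<tau>) t = z v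
    explains the argument of Gamma. The factor 2 from folding an even function cancels dt = dv / 2.
    The form \<open>0 + 2 * t\<close> fits the affine substitution rule.\<close>
  have log_fold: "log_fold gaussian t * cis (\<tau> * t) =
      2 * (exp (z \<tau> * of_real (0 + 2 * t)) * of_real (exp (- exp (0 + 2 * t))))" for \<tau> t
  proof -
    have "exp (z \<tau> * of_real (0 + 2 * t)) = of_real (exp (t / 2)) * cis (\<tau> * t)"
      by (simp add: z_def cis_conv_exp exp_add[symmetric] algebra_simps flip: exp_of_real)
    moreover have "(exp t)\<^sup>2 = exp (0 + 2 * t)" by (simp add: exp_double)
    ultimately show ?thesis
      by (simp add: log_fold_def gaussian_def scaleR_conv_of_real)
  qed
  have int: "has_bochner_integral lborel (\<lambda>t. log_fold gaussian t * cis (\<tau> * t)) (Gamma (z \<tau>))" for \<tau>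
  proof -
    note G = has_bochner_integral_Gamma_exp[OF z[of \<tau>]]
    have "integrable lborel (\<lambda>t. exp (z \<tau> * of_real (0 + 2 * t)) * of_real (exp (- exp (0 + 2 * t))))"
      using lborel_integrable_real_affine[of "\<lambda>v. exp (z \<tau> * of_real v) * of_real (exp (- exp v))" 2 0] G
      by (simp add: has_bochner_integral_iff)
    moreover have "2 * (LINT t|lborel. exp (z \<tau> * of_real (0 + 2 * t)) * of_real (exp (- exp (0 + 2 * t)))) = Gamma (z \<tau>)"
      using lborel_integral_real_affine[of 2 "\<lambda>v. exp (z \<tau> * of_real v) * of_real (exp (- exp v))" 0] G
      by (simp add: has_bochner_integral_iff scaleR_conv_of_real)
    ultimately show ?thesis
      unfolding log_fold has_bochner_integral_iff by (simp del: add_0)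
  qed
  define h where "h x = \<bar>x\<bar> powr (- 1 / 2) *\<^sub>R gaussian x" for x
  have [measurable]: "h \<in> borel_measurable borel" unfolding h_def by measurable
  have h_minus: "h (- x) = h x" for x by (simp add: h_def gaussian_def)
  have "log_fold gaussian t = 2 * (exp t *\<^sub>R h (exp t))" for t
  proof -
    have "exp t * exp t powr (- 1 / 2) = exp (t / 2)"
      by (simp add: powr_def exp_add[symmetric])
    then show ?thesis
      by (simp add: h_def log_fold_def gaussian_def scaleR_conv_of_real flip: of_real_mult)
  qed
  \<comment> \<open>At \<tau> = 0 the character is trivial, so the Gamma integral already contains
    absolute convergence of the Mellin integral; it is transported back to the half-line and then
    reflected.\<close>
  then have "integrable lborel (\<lambda>t. 2 * (exp t *\<^sub>R h (exp t)))"
    using int[of 0] by (simp add: has_bochner_integral_iff)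
  then have "integrable lborel (\<lambda>t. 1 / 2 * (2 * (exp t *\<^sub>R h (exp t))))" by (rule integrable_mult_right)
  then have "integrable lborel (\<lambda>t. exp t *\<^sub>R h (exp t))" by (simp only: mult.assoc[symmetric]) simp
  then have 1: "integrable lborel (\<lambda>x. indicator {0<..} x *\<^sub>R h x)"
    using integrable_exp_substitution[of h] by (simp add: set_integrable_def)
  from lborel_integrable_real_affine[OF 1, of "-1" 0]
  have 2: "integrable lborel (\<lambda>x. indicator {0<..} (- x) *\<^sub>R h x)" by (simp add: h_minus)
  have "integrable lborel (\<lambda>x. indicator {0<..} x *\<^sub>R h x + indicator {0<..} (- x) *\<^sub>R h x)"
    using 1 2 by (rule Bochner_Integration.integrable_add)
  also have "(\<lambda>x. indicator {0<..} x *\<^sub>R h x + indicator {0<..} (- x) *\<^sub>R h x) = h"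
    by (auto simp: fun_eq_iff indicator_def h_def)
  finally show mi: "mellin_integrable gaussian" unfolding mellin_integrable_def h_def[abs_def] .
  show "mellin_integral gaussian \<tau> = Gamma (1 / 4 + \<i> / 2 * complex_of_real \<tau>)"
    using mellin_integral_eq_fourier[OF borel_measurable_gaussian mi, of \<tau>] int[of \<tau>]
    by (simp add: fourier_def has_bochner_integral_iff z_def)
qed

section \<open>The extension of the Mellin transform\<close>

text \<open>Members of \<open>L2\<close> are only Lebesgue measurable, a property that composition
  need not preserve. The analysis is therefore carried out on a Borel representative.\<close>

lemma L2_borel_representative:
  assumes "f \<in> L2"
  shows "\<exists>g\<in>borel_measurable borel. (AE x in lborel. f x = g x) \<and> integrable lborel (\<lambda>x. (cmod (g x))\<^sup>2)"
proof -
  have fm: "f \<in> borel_measurable lebesgue" and f2: "integrable lebesgue (\<lambda>x. (cmod (f x))\<^sup>2)"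
    using assms by (auto simp: L2_def)
  have "(\<lambda>x. Re (f x)) \<in> borel_measurable lebesgue" "(\<lambda>x. Im (f x)) \<in> borel_measurable lebesgue"
    using fm by measurable
  then obtain r i where [measurable]: "r \<in> borel_measurable lborel" "i \<in> borel_measurable lborel"
    and ri: "AE x in lborel. Re (f x) = r x" "AE x in lborel. Im (f x) = i x"
    using completion_ex_borel_measurable_real by metis
  define g where "g x = Complex (r x) (i x)" for x
  have gm [measurable]: "g \<in> borel_measurable borel"
  proof -
    have "g = (\<lambda>x. of_real (r x) + \<i> * of_real (i x))" by (simp add: g_def Complex_eq fun_eq_iff)
    then show ?thesis by simp
  qed
  have ae: "AE x in lborel. f x = g x"
    using ri by eventually_elim (simp add: g_def complex_eq_iff)
  have "integrable lebesgue (\<lambda>x. (cmod (g x))\<^sup>2)"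
  proof (rule integrable_cong_AE_imp[OF f2])
    show "(\<lambda>x. (cmod (g x))\<^sup>2) \<in> borel_measurable lebesgue"
      by (rule measurable_completion) measurable
    show "AE x in lebesgue. (cmod (f x))\<^sup>2 = (cmod (g x))\<^sup>2"
      using AE_completion[OF ae] by eventually_elim simp
  qed
  then have "integrable lborel (\<lambda>x. (cmod (g x))\<^sup>2)" by (simp add: integrable_completion)
  with gm ae show ?thesis by blast
qed

lemma borel_in_L2:
  assumes [measurable]: "g \<in> borel_measurable borel" and "integrable lborel (\<lambda>x. (cmod (g x))\<^sup>2)"
  shows "g \<in> L2"
  using assms(2) by (simp add: L2_def integrable_completion measurable_completion)

lemma L2dist_AE_cong:
  assumes "f \<in> L2" "g \<in> L2"
    and [measurable]: "f' \<in> borel_measurable borel" "g' \<in> borel_measurable borel"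
    and "AE x in lborel. f x = f' x" "AE x in lborel. g x = g' x"
  shows "L2dist f g = sqrt (LINT x|lborel. (cmod (f' x - g' x))\<^sup>2)"
proof -
  have [measurable]: "f \<in> borel_measurable lebesgue" "g \<in> borel_measurable lebesgue"
    using assms by (auto simp: L2_def)
  have "(LINT x|lebesgue. (cmod (f x - g x))\<^sup>2) = (LINT x|lebesgue. (cmod (f' x - g' x))\<^sup>2)"
  proof (rule integral_cong_AE)
    show "AE x in lebesgue. (cmod (f x - g x))\<^sup>2 = (cmod (f' x - g' x))\<^sup>2"
      using assms(5,6)[THEN AE_completion] by eventually_elim simp
    show "(\<lambda>x. (cmod (f' x - g' x))\<^sup>2) \<in> borel_measurable lebesgue"
      by (rule measurable_completion) measurable
  qed measurable
  also have "\<dots> = (LINT x|lborel. (cmod (f' x - g' x))\<^sup>2)"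
    by (rule integral_completion) measurable
  finally show ?thesis by (simp add: L2dist_def)
qed

lemma mellin_integral_AE_cong:
  assumes [measurable]: "f \<in> borel_measurable lebesgue" "g \<in> borel_measurable borel"
    and ae: "AE x in lborel. f x = g x"
  shows "mellin_integral f \<tau> = mellin_integral g \<tau>"
proof -
  have [measurable]: "mellin_kernel \<tau> \<in> borel_measurable lebesgue" "g \<in> borel_measurable lebesgue"
    by (rule measurable_completion, measurable)+
  show ?thesis
    unfolding mellin_integral_lebesgue
  proof (rule integral_cong_AE)
    show "AE x in lebesgue. mellin_kernel \<tau> x * f x = mellin_kernel \<tau> x * g x"
      using AE_completion[OF ae] by eventually_elim simp
  qed measurable
qed

text \<open>K keeps a distance d from 0, so the weight is at most d^(-1/2) there; K is also bounded,
  so this constant on an interval containing K is in L2, and the product with g is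
  integrable.\<close>

lemma mellin_integrable_compact_support:
  assumes [measurable]: "g \<in> borel_measurable borel" and g2: "integrable lborel (\<lambda>x. (cmod (g x))\<^sup>2)"
    and K: "compact K" "K \<subseteq> - {0}" and ae: "AE x in lborel. x \<notin> K \<longrightarrow> g x = 0"
  shows "mellin_integrable g"
proof -
  have "open (- K)" "0 \<in> - K" using K by (auto simp: compact_imp_closed)
  then obtain d where d: "d > 0" "ball 0 d \<subseteq> - K" using open_contains_ball by blast
  obtain R where R: "\<And>x. x \<in> K \<Longrightarrow> \<bar>x\<bar> \<le> R"
    using compact_imp_bounded[OF K(1)] by (auto simp: bounded_iff)
  define q where "q x = complex_of_real (d powr (- 1 / 2) * indicator {-R..R} x)" for x :: real
  have [measurable]: "q \<in> borel_measurable borel" unfolding q_def by measurable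
  have q2: "integrable lborel (\<lambda>x. (cmod (q x))\<^sup>2)"
  proof -
    have "(cmod (q x))\<^sup>2 = (d powr (- 1 / 2))\<^sup>2 * indicator {-R..R} x" for x
      by (auto simp: q_def indicator_def)
    then show ?thesis by simp
  qed
  have i: "integrable lborel (\<lambda>x. q x * g x)"
    using q2 g2 by (intro integrable_mult_L2) auto
  show ?thesis
    unfolding mellin_integrable_def
  proof (rule Bochner_Integration.integrable_bound[OF i])
    show "AE x in lborel. norm (\<bar>x\<bar> powr (- 1 / 2) *\<^sub>R g x) \<le> norm (q x * g x)"
      using ae
    proof eventually_elim
      case (elim x)
      show ?case
      proof (cases "x \<in> K")
        case True
        then have "d \<le> \<bar>x\<bar>" using d(2) by (force simp: dist_norm not_less)
        then have "\<bar>x\<bar> powr (- 1 / 2) \<le> d powr (- 1 / 2)" using d(1) by (intro powr_mono2') auto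
        moreover have "x \<in> {-R..R}" using R[OF True] by auto
        ultimately show ?thesis by (simp add: q_def norm_mult mult_right_mono)
      qed (use elim in simp)
    qed
  qed measurable
qed

lemma compactly_supported_annular_trunc: "compactly_supported_off_0 (annular_trunc N f)"
proof -
  define K where "K = {- real (Suc N)..- (1 / real (Suc N))} \<union> {1 / real (Suc N)..real (Suc N)}"
  have "compact K" "K \<subseteq> - {0}" by (auto simp: K_def)
  moreover have "annular_trunc N f x = 0" if "x \<notin> K" for x
    using that by (auto simp: K_def annular_trunc_def abs_if split: if_splits)
  ultimately show ?thesis unfolding compactly_supported_off_0_def by blast
qed

text \<open>Existence is what gives the \<open>SOME\<close> in \<open>M0\<close> its content. The
  transform is chosen for a Borel representative of each f.\<close>

lemma ex_mellin_extension: "\<exists>T. is_mellin_extension T"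
proof -
  have "\<exists>m. \<exists>g. (AE x in lborel. f x = g x) \<and> mellin_L2 g m" if "f \<in> L2" for f
    using L2_borel_representative[OF that] mellin_L2_exists by blast
  then obtain T where T: "\<And>f. f \<in> L2 \<Longrightarrow> \<exists>g. (AE x in lborel. f x = g x) \<and> mellin_L2 g (T f)"
    by metis
  have "is_mellin_extension T"
    unfolding is_mellin_extension_def
  proof (intro conjI ballI impI allI)
    fix f assume f: "f \<in> L2"
    then obtain g where g: "AE x in lborel. f x = g x" "mellin_L2 g (T f)" using T by blast
    show "T f \<in> L2" using g(2) by (intro borel_in_L2) (auto simp: mellin_L2_def)
    have gm: "g \<in> borel_measurable borel" and g2: "integrable lborel (\<lambda>x. (cmod (g x))\<^sup>2)"
      using g(2) by (auto simp: mellin_L2_def)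
    have fm: "f \<in> borel_measurable lebesgue" using f by (simp add: L2_def)
    show "AE \<tau> in lebesgue. T f \<tau> = mellin_integral f \<tau>" if cs: "compactly_supported_off_0 f"
    proof -
      obtain K where K: "compact K" "K \<subseteq> - {0}" "AE x in lebesgue. x \<notin> K \<longrightarrow> f x = 0"
        using cs by (auto simp: compactly_supported_off_0_def)
      have "AE x in lborel. x \<notin> K \<longrightarrow> f x = 0" using K(3) by (simp add: AE_completion_iff)
      with g(1) have "AE x in lborel. x \<notin> K \<longrightarrow> g x = 0" by eventually_elim auto
      then have "mellin_integrable g" by (rule mellin_integrable_compact_support[OF gm g2 K(1,2)])
      from mellin_L2_eq_mellin_integral[OF g(2) this] show ?thesis
        unfolding mellin_integral_AE_cong[OF fm gm g(1)] by (rule AE_completion)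
    qed
    fix \<epsilon> :: real assume "\<epsilon> > 0"
    show "\<exists>\<delta>>0. \<forall>h\<in>L2. L2dist f h < \<delta> \<longrightarrow> L2dist (T f) (T h) < \<epsilon>"
    \<comment> \<open>sqrt (64 * pi) is the Lipschitz constant from
      \<open>mellin_L2_dist_le\<close>, so \<delta> does not depend on f.\<close>
    proof (intro exI[of _ "\<epsilon> / sqrt (64 * pi)"] conjI ballI impI)
      show "0 < \<epsilon> / sqrt (64 * pi)" using \<open>\<epsilon> > 0\<close> by simp
      fix h assume h: "h \<in> L2" and d: "L2dist f h < \<epsilon> / sqrt (64 * pi)"
      obtain k where k: "AE x in lborel. h x = k x" "mellin_L2 k (T h)" using T[OF h] by blast
      have km: "k \<in> borel_measurable borel" and Tm: "T f \<in> borel_measurable borel" "T h \<in> borel_measurable borel"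
        and T2: "T f \<in> L2" "T h \<in> L2"
        using g(2) k(2) by (auto simp: mellin_L2_def intro: borel_in_L2)
      have "L2dist (T f) (T h) = sqrt (LINT x|lborel. (cmod (T f x - T h x))\<^sup>2)"
        by (rule L2dist_AE_cong) (use T2 Tm in auto)
      also have "\<dots> \<le> sqrt (64 * pi * (LINT x|lborel. (cmod (g x - k x))\<^sup>2))"
        using mellin_L2_dist_le[OF g(2) k(2)] by (rule real_sqrt_le_mono)
      also have "\<dots> = sqrt (64 * pi) * L2dist f h"
        unfolding L2dist_AE_cong[OF f h gm km g(1) k(1)] by (rule real_sqrt_mult)
      also have "\<dots> < \<epsilon>" using d by (simp add: field_simps)
      finally show "L2dist (T f) (T h) < \<epsilon>" .
    qed
  qed
  then show ?thesis by blast
qed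

text \<open>On truncations \<open>T\<close> agrees with the integral, as they are compactly
  supported off 0; continuity of \<open>T\<close> at f then forces its value to be the same L2 limit
  m. Linearity of \<open>T\<close> is never invoked.\<close>

lemma mellin_extension_eq:
  assumes T: "is_mellin_extension T" and f: "f \<in> L2"
    and ae: "AE x in lborel. f x = g x" and g: "mellin_L2 g m"
  shows "AE \<tau> in lebesgue. T f \<tau> = m \<tau>"
proof -
  have gm: "g \<in> borel_measurable borel" and g2: "integrable lborel (\<lambda>x. (cmod (g x))\<^sup>2)"
    and mm: "m \<in> borel_measurable borel" and m2: "integrable lborel (\<lambda>x. (cmod (m x))\<^sup>2)"
    and lim: "(\<lambda>N. LINT \<tau>|lborel. (cmod (mellin_integral (annular_trunc N g) \<tau> - m \<tau>))\<^sup>2) \<longlonglongrightarrow> 0"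
    using g by (auto simp: mellin_L2_def)
  obtain h where hm: "h \<in> borel_measurable borel" and h: "AE \<tau> in lborel. T f \<tau> = h \<tau>"
    and h2: "integrable lborel (\<lambda>x. (cmod (h x))\<^sup>2)"
    using L2_borel_representative[of "T f"] T f by (auto simp: is_mellin_extension_def)
  define t where "t N = annular_trunc N g" for N
  have tm: "t N \<in> borel_measurable borel" and t2: "integrable lborel (\<lambda>x. (cmod (t N x))\<^sup>2)" for N
    using gm annular_trunc_L2[OF gm] by (auto simp: t_def)
  have tL: "t N \<in> L2" for N by (rule borel_in_L2[OF tm t2])
  define mt where "mt N = mellin_integral (t N)" for N
  have mtm: "mt N \<in> borel_measurable borel" and mt2: "integrable lborel (\<lambda>x. (cmod (mt N x))\<^sup>2)" for N
    unfolding mt_def t_def by (auto intro: measurable_mellin_annular_trunc integrable_mellin_annular_trunc gm)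
  have TL: "T f \<in> L2" "T (t N) \<in> L2" for N
    using T f tL by (auto simp: is_mellin_extension_def)
  have "AE \<tau> in lebesgue. T (t N) \<tau> = mt N \<tau>" for N
    using T tL[of N] compactly_supported_annular_trunc[of N g] by (auto simp: is_mellin_extension_def mt_def t_def)
  then have Tt: "AE \<tau> in lborel. T (t N) \<tau> = mt N \<tau>" for N by (simp add: AE_completion_iff)
  have "L2dist f (t N) = sqrt (LINT x|lborel. (cmod (t N x - g x))\<^sup>2)" for N
    unfolding L2dist_AE_cong[OF f tL gm tm ae AE_I2[OF refl]] by (subst L2_dist_commute) (rule refl)
  moreover have "(\<lambda>N. sqrt (LINT x|lborel. (cmod (t N x - g x))\<^sup>2)) \<longlonglongrightarrow> sqrt 0"
    unfolding t_def by (intro tendsto_real_sqrt annular_trunc_L2_tendsto gm g2)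
  ultimately have d0: "(\<lambda>N. L2dist f (t N)) \<longlonglongrightarrow> 0" by simp
  have "(\<lambda>N. L2dist (T f) (T (t N))) \<longlonglongrightarrow> 0"
  proof (rule LIMSEQ_I)
    fix e :: real assume "e > 0"
    then obtain \<delta> where \<delta>: "\<delta> > 0" "\<And>k. k \<in> L2 \<Longrightarrow> L2dist f k < \<delta> \<Longrightarrow> L2dist (T f) (T k) < e"
      using T f unfolding is_mellin_extension_def by meson
    from order_tendstoD(2)[OF d0 \<delta>(1)] obtain N where "\<And>n. n \<ge> N \<Longrightarrow> L2dist f (t n) < \<delta>"
      by (auto simp: eventually_sequentially)
    then show "\<exists>N. \<forall>n\<ge>N. norm (L2dist (T f) (T (t n)) - 0) < e"
      using \<delta>(2) tL by (intro exI[of _ N]) (auto simp: L2dist_def)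
  qed
  then have "(\<lambda>N. (L2dist (T f) (T (t N)))\<^sup>2) \<longlonglongrightarrow> 0\<^sup>2" by (rule tendsto_power)
  moreover have "(L2dist (T f) (T (t N)))\<^sup>2 = (LINT x|lborel. (cmod (mt N x - h x))\<^sup>2)" for N
    unfolding L2dist_AE_cong[OF TL hm mtm h Tt] by (subst L2_dist_commute) simp
  ultimately have lh: "(\<lambda>N. LINT x|lborel. (cmod (mt N x - h x))\<^sup>2) \<longlonglongrightarrow> 0" by simp
  have "(LINT x|lborel. (cmod (h x - m x))\<^sup>2) \<le>
      2 * (LINT x|lborel. (cmod (mt N x - h x))\<^sup>2) + 2 * (LINT x|lborel. (cmod (mt N x - m x))\<^sup>2)" for N
    using L2_triangle[of h lborel "mt N" m] hm mtm mm h2 m2 mt2 L2_dist_commute[of lborel h "mt N"] by simp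
  moreover have "(\<lambda>N. 2 * (LINT x|lborel. (cmod (mt N x - h x))\<^sup>2) + 2 * (LINT x|lborel. (cmod (mt N x - m x))\<^sup>2))
      \<longlonglongrightarrow> 2 * 0 + 2 * 0"
    using lim by (intro tendsto_add tendsto_mult tendsto_const lh) (simp add: mt_def t_def)
  ultimately have "(LINT x|lborel. (cmod (h x - m x))\<^sup>2) \<le> 2 * 0 + 2 * 0"
    by (intro LIMSEQ_le_const) blast+
  moreover have "integrable lborel (\<lambda>x. (cmod (h x - m x))\<^sup>2)"
    using hm mm h2 m2 by (intro integrable_diff_L2) auto
  ultimately have "AE x in lborel. (cmod (h x - m x))\<^sup>2 = 0"
    by (subst integral_nonneg_eq_0_iff_AE[symmetric]) (auto intro: antisym)
  with h have "AE \<tau> in lborel. T f \<tau> = m \<tau>" by eventually_elim simp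
  then show ?thesis by (rule AE_completion)
qed

lemma M0_AE_eq:
  assumes "f \<in> L2" "AE x in lborel. f x = g x" "mellin_L2 g m"
  shows "AE \<tau> in lebesgue. M0 f \<tau> = m \<tau>"
  using mellin_extension_eq[OF _ assms] someI_ex[OF ex_mellin_extension] unfolding M0_def by blast

section \<open>Dilation correlations\<close>

text \<open>Taking s = 0 shows that p and q have the same mass I. If I > 0, division by I makes them
  probability densities and Levy's uniqueness theorem for characteristic functions applies; if I = 0
  both vanish almost everywhere.\<close>

lemma fourier_nonneg_unique:
  fixes p q :: "real \<Rightarrow> real"
  assumes p: "integrable lborel p" "\<And>x. p x \<ge> 0" and q: "integrable lborel q" "\<And>x. q x \<ge> 0"
    and eq: "\<And>s. (LINT \<tau>|lborel. of_real (p \<tau>) * cis (- (\<tau> * s))) = (LINT \<tau>|lborel. of_real (q \<tau>) * cis (- (\<tau> * s)))"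
  shows "AE x in lborel. p x = q x"
proof -
  have [measurable]: "p \<in> borel_measurable borel" "q \<in> borel_measurable borel" using p q by auto
  define I where "I = (LINT x|lborel. p x)"
  have "complex_of_real (LINT x|lborel. p x) = complex_of_real (LINT x|lborel. q x)"
    using eq[of 0] by simp
  then have Iq: "I = (LINT x|lborel. q x)" unfolding I_def by (simp only: of_real_eq_iff)
  show ?thesis
  proof (cases "I = 0")
    case True
    then have "AE x in lborel. p x = 0" "AE x in lborel. q x = 0"
      using integral_nonneg_eq_0_iff_AE[OF p(1)] integral_nonneg_eq_0_iff_AE[OF q(1)] p(2) q(2) Iq
      unfolding I_def by simp_all
    then show ?thesis by eventually_elim simp
  next
    case False
    have "I \<ge> 0" unfolding I_def using p by simp
    with False have I: "I > 0" by simp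
    define D where "D r = density lborel (\<lambda>x. ennreal (r x / I))" for r :: "real \<Rightarrow> real"
    have dist: "real_distribution (D r)"
      if r: "integrable lborel r" "\<And>x. r x \<ge> 0" "(LINT x|lborel. r x) = I" for r
    proof -
      have [measurable]: "r \<in> borel_measurable borel" using r by auto
      have "(\<integral>\<^sup>+x. ennreal (r x / I) \<partial>lborel) = ennreal (LINT x|lborel. r x / I)"
        using r I by (intro nn_integral_eq_integral) auto
      also have "\<dots> = 1" using r I by simp
      finally have "prob_space (D r)"
        by (intro prob_spaceI) (simp add: D_def emeasure_density)
      then show ?thesis
        by (simp add: real_distribution_def real_distribution_axioms_def D_def)
    qed
    have char: "char (D r) t = (LINT \<tau>|lborel. of_real (r \<tau>) * cis (- (\<tau> * (- t)))) / of_real I"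
      if r: "integrable lborel r" "\<And>x. r x \<ge> 0" for r t
    proof -
      have [measurable]: "r \<in> borel_measurable borel" using r by auto
      have "char (D r) t = (LINT x|lborel. (r x / I) *\<^sub>R iexp (t * x))"
        unfolding char_def D_def using r I by (subst integral_density) auto
      also have "\<dots> = (LINT \<tau>|lborel. of_real (r \<tau>) * cis (- (\<tau> * (- t))) / of_real I)"
        by (intro Bochner_Integration.integral_cong) (auto simp: scaleR_conv_of_real cis_conv_exp mult_ac)
      finally show ?thesis by simp
    qed
    have "D p = D q"
      using dist[OF p I_def[symmetric]] dist[OF q Iq[symmetric]]
      by (rule Levy_uniqueness) (rule ext, simp only: char[OF p] char[OF q] eq)
    then have "AE x in lborel. ennreal (p x / I) = ennreal (q x / I)"
      unfolding D_def
      by (intro sigma_finite_measure.density_unique[OF sigma_finite_lborel]) auto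
    then show ?thesis
      by eventually_elim (use p(2) q(2) I in auto)
  qed
qed

lemma AE_lborel_scale:
  assumes "AE x in lborel. P x" "a \<noteq> (0::real)"
  shows "AE x in lborel. P (a * x)"
proof -
  \<comment> \<open>\<open>P\<close> carries no measurability, so the change of variable is applied
    to a Borel null set containing its exceptions.\<close>
  obtain N where N: "N \<in> null_sets lborel" "{x. \<not> P x} \<subseteq> N"
    using assms(1) by (auto simp: eventually_ae_filter)
  have [measurable]: "N \<in> sets borel" using N(1) by auto
  have "AE x in lborel. x \<notin> N" using N(1) by (rule AE_not_in)
  then have "AE x in lborel. 0 + a * x \<notin> N" by (intro AE_borel_affine assms(2)) auto
  then show ?thesis by eventually_elim (use N(2) in auto)
qed

text \<open>Dilation by a nonzero a preserves null sets; at a = 0 the value would depend on f at the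
  single point 0.\<close>

lemma dilation_correlation_AE_cong:
  assumes [measurable]: "f \<in> borel_measurable lebesgue" "g \<in> borel_measurable borel"
    and ae: "AE x in lborel. f x = g x" and "a \<noteq> 0"
  shows "dilation_correlation f a = dilation_correlation g a"
  unfolding dilation_correlation_def
proof (rule integral_cong_AE)
  have "(\<lambda>x. a *\<^sub>R x) \<in> lebesgue \<rightarrow>\<^sub>M lebesgue" by (rule lebesgue_measurable_scaling)
  then have [measurable]: "(\<lambda>x. f (a * x)) \<in> borel_measurable lebesgue"
    using measurable_compose[OF _ assms(1)] by fastforce
  show "(\<lambda>x. cnj (f x) * f (a * x)) \<in> borel_measurable lebesgue" by measurable
  show "(\<lambda>x. cnj (g x) * g (a * x)) \<in> borel_measurable lebesgue"
    by (rule measurable_completion) measurable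
  have "AE x in lborel. cnj (f x) * f (a * x) = cnj (g x) * g (a * x)"
    using ae AE_lborel_scale[OF ae \<open>a \<noteq> 0\<close>] by eventually_elim simp
  then show "AE x in lebesgue. cnj (f x) * f (a * x) = cnj (g x) * g (a * x)" by (rule AE_completion)
qed

lemma dilation_correlation_even:
  assumes [measurable]: "g \<in> borel_measurable borel"
    and even: "AE x in lborel. g (- x) = g x"
  shows "dilation_correlation g (- a) = dilation_correlation g a"
proof (cases "a = 0")
  case False
  have "AE x in lborel. g (- (a * x)) = g (a * x)" by (rule AE_lborel_scale[OF even False])
  then show ?thesis
    unfolding dilation_correlation_lborel[OF assms(1)]
    by (intro integral_cong_AE) (auto elim: eventually_mono)
qed simp

text \<open>g and its reflection have equal norms, so their squared distance is twice the squared
  norm minus twice the real part of the correlation at -1. That correlation equals the one at 1,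
  which is the squared norm, so the distance is 0.\<close>

lemma even_if_dilation_correlation_eq:
  assumes [measurable]: "g \<in> borel_measurable borel"
    and g: "integrable lborel (\<lambda>x. (cmod (g x))\<^sup>2)"
    and eq: "dilation_correlation g (- 1) = dilation_correlation g 1"
  shows "AE x in lborel. g (- x) = g x"
proof -
  have g': "integrable lborel (\<lambda>x. (cmod (g (- x)))\<^sup>2)"
    using integrable_power2_dilate[OF g, of "-1"] by simp
  have refl: "(LINT x|lborel. (cmod (g (- x)))\<^sup>2) = (LINT x|lborel. (cmod (g x))\<^sup>2)"
    using lborel_integral_real_affine[of "-1" "\<lambda>x. (cmod (g x))\<^sup>2" 0] by simp
  have ic: "integrable lborel (\<lambda>x. cnj (g x) * g (- x))"
    using integrable_dilation_correlation[OF assms(1) g, of "-1"] by simp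
  have pt: "(cmod (z - w))\<^sup>2 = (cmod z)\<^sup>2 + (cmod w)\<^sup>2 - 2 * Re (cnj w * z)" for z w
    by (simp add: cmod_power2) (simp add: power2_eq_square algebra_simps)
  have int: "integrable lborel (\<lambda>x. (cmod (g (- x) - g x))\<^sup>2)"
    using g g' by (intro integrable_diff_L2) auto
  have iRe: "integrable lborel (\<lambda>x. Re (cnj (g x) * g (- x)))"
    by (rule integrable_Re[OF ic])
  have "(LINT x|lborel. (cmod (g (- x) - g x))\<^sup>2) =
      (LINT x|lborel. (cmod (g (- x)))\<^sup>2) + (LINT x|lborel. (cmod (g x))\<^sup>2) - 2 * Re (LINT x|lborel. cnj (g x) * g (- x))"
    unfolding pt using g g' iRe integral_Re[OF ic] by (simp del: times_complex.sel)
  also have "(LINT x|lborel. cnj (g x) * g (- x)) = of_real (LINT x|lborel. (cmod (g x))\<^sup>2)"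
    using eq by (simp add: dilation_correlation_1[OF assms(1)] dilation_correlation_lborel[OF assms(1), of "-1"])
  finally have "(LINT x|lborel. (cmod (g (- x) - g x))\<^sup>2) = 0" using refl by simp
  then have "AE x in lborel. (cmod (g (- x) - g x))\<^sup>2 = 0"
    using int by (subst (asm) integral_nonneg_eq_0_iff_AE) auto
  then show ?thesis by eventually_elim simp
qed

text \<open>Of the Gaussian only its evenness matters here, so any even \<open>h\<close> may be the
  reference. Plancherel controls sums over the dilations exp s and - exp s; the evenness of both
  functions splits these sums in the converse direction.\<close>

theorem dilation_correlation_proportional_iff:
  assumes g: "mellin_L2 g m" and h: "mellin_L2 h k" and "c \<ge> 0"
    and h_even: "AE x in lborel. h (- x) = h x"
  shows "(\<forall>a. a \<noteq> 0 \<longrightarrow> dilation_correlation g a = of_real c * dilation_correlation h a) \<longleftrightarrow>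
    (AE x in lborel. g (- x) = g x) \<and> (AE \<tau> in lborel. (cmod (m \<tau>))\<^sup>2 = c * (cmod (k \<tau>))\<^sup>2)"
    (is "?L \<longleftrightarrow> ?E \<and> ?M")
proof -
  have [measurable]: "g \<in> borel_measurable borel" "h \<in> borel_measurable borel"
      "m \<in> borel_measurable borel" "k \<in> borel_measurable borel"
    and g2: "integrable lborel (\<lambda>x. (cmod (g x))\<^sup>2)" and m2: "integrable lborel (\<lambda>x. (cmod (m x))\<^sup>2)"
    and k2: "integrable lborel (\<lambda>x. (cmod (k x))\<^sup>2)"
    using g h by (auto simp: mellin_L2_def)
  have scaled: "(LINT \<tau>|lborel. of_real (c * (cmod (k \<tau>))\<^sup>2) * cis (- (\<tau> * s))) =
      of_real (2 * pi * exp (s / 2)) * (of_real c * dilation_correlation h (exp s) + of_real c * dilation_correlation h (- exp s))" for s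
  proof -
    have "(LINT \<tau>|lborel. of_real (c * (cmod (k \<tau>))\<^sup>2) * cis (- (\<tau> * s))) =
        of_real c * (LINT \<tau>|lborel. of_real ((cmod (k \<tau>))\<^sup>2) * cis (- (\<tau> * s)))"
      by (simp only: of_real_mult mult.assoc integral_mult_right_zero)
    also have "\<dots> = of_real (2 * pi * exp (s / 2)) * (of_real c * dilation_correlation h (exp s) + of_real c * dilation_correlation h (- exp s))"
      unfolding mellin_L2_Plancherel[OF h] by (simp add: algebra_simps)
    finally show ?thesis .
  qed
  show ?thesis
  proof
    assume L: ?L
    have "dilation_correlation g (- 1) = dilation_correlation g 1"
      using L dilation_correlation_even[OF \<open>h \<in> borel_measurable borel\<close> h_even, of 1] by simp
    then have ?E by (intro even_if_dilation_correlation_eq g2) auto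
    moreover have ?M
    proof (rule fourier_nonneg_unique)
      show "(LINT \<tau>|lborel. of_real ((cmod (m \<tau>))\<^sup>2) * cis (- (\<tau> * s))) =
          (LINT \<tau>|lborel. of_real (c * (cmod (k \<tau>))\<^sup>2) * cis (- (\<tau> * s)))" for s
        unfolding scaled mellin_L2_Plancherel[OF g] using L by simp
    qed (use m2 k2 \<open>c \<ge> 0\<close> in auto)
    ultimately show "?E \<and> ?M" by blast
  next
    assume R: "?E \<and> ?M"
    note g_minus = dilation_correlation_even[OF \<open>g \<in> borel_measurable borel\<close>]
    note h_minus = dilation_correlation_even[OF \<open>h \<in> borel_measurable borel\<close> h_even]
    have pos: "dilation_correlation g (exp s) = of_real c * dilation_correlation h (exp s)" for s
    proof -
      have "(LINT \<tau>|lborel. of_real ((cmod (m \<tau>))\<^sup>2) * cis (- (\<tau> * s))) =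
          (LINT \<tau>|lborel. of_real (c * (cmod (k \<tau>))\<^sup>2) * cis (- (\<tau> * s)))"
      proof (rule integral_cong_AE)
        from R have ?M by blast
        then show "AE \<tau> in lborel. of_real ((cmod (m \<tau>))\<^sup>2) * cis (- (\<tau> * s)) =
            of_real (c * (cmod (k \<tau>))\<^sup>2) * cis (- (\<tau> * s))"
          by eventually_elim simp
      qed measurable
      then have "of_real (2 * pi * exp (s / 2)) * (2 * dilation_correlation g (exp s)) =
          of_real (2 * pi * exp (s / 2)) * (2 * (of_real c * dilation_correlation h (exp s)))"
        unfolding scaled mellin_L2_Plancherel[OF g] using R by (simp add: g_minus h_minus)
      then show ?thesis by simp
    qed
    show ?L
    proof (intro allI impI)
      fix a :: real assume "a \<noteq> 0"
      \<comment> \<open>The dilations exp s and - exp s exhaust the nonzero reals.\<close>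
      then have "a = exp (ln \<bar>a\<bar>) \<or> a = - exp (ln \<bar>a\<bar>)" by auto
      then show "dilation_correlation g a = of_real c * dilation_correlation h a"
        using pos[of "ln \<bar>a\<bar>"] R by (metis g_minus h_minus)
    qed
  qed
qed

theorem theorem1p2:
  fixes f :: "real \<Rightarrow> complex" and c0 :: real
  assumes "f \<in> L2" and "c0 \<ge> 0"
  shows "(\<forall>a::real. a \<noteq> 0 \<longrightarrow>
            dilation_correlation f a = complex_of_real (c0 * (1 + a\<^sup>2) powr (- 1 / 2))) \<longleftrightarrow>
         (AE x in lebesgue. f (- x) = f x) \<and>
         (AE \<tau> in lebesgue.
            cmod (M0 f \<tau>) = sqrt c0 / pi powr (1 / 4)
              * cmod (Gamma (1 / 4 + \<i> / 2 * complex_of_real \<tau>)))"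
proof -
  obtain g where gm: "g \<in> borel_measurable borel" and fg: "AE x in lborel. f x = g x"
    and g2: "integrable lborel (\<lambda>x. (cmod (g x))\<^sup>2)"
    using L2_borel_representative[OF assms(1)] by blast
  obtain m where m: "mellin_L2 g m" using mellin_L2_exists[OF gm g2] by blast
  obtain k where k: "mellin_L2 gaussian k"
    using mellin_L2_exists[OF borel_measurable_gaussian gaussian_L2] by blast
  have kGamma: "AE \<tau> in lborel. k \<tau> = Gamma (1 / 4 + \<i> / 2 * complex_of_real \<tau>)"
    using mellin_L2_eq_mellin_integral[OF k gaussian_mellin_integrable] by (simp only: mellin_integral_gaussian)
  have M0m: "AE \<tau> in lborel. M0 f \<tau> = m \<tau>"
    using M0_AE_eq[OF assms(1) fg m] by (simp add: AE_completion_iff)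
  have fm: "f \<in> borel_measurable lebesgue" using assms(1) by (simp add: L2_def)
  \<comment> \<open>The division cancels the factor sqrt pi in the correlation of
    \<open>gaussian\<close>.\<close>
  define c where "c = c0 / sqrt pi"
  have c: "c \<ge> 0" using assms(2) by (simp add: c_def)
  have sqrt_c: "(sqrt c0 / pi powr (1 / 4))\<^sup>2 = c"
  proof -
    have "(pi powr (1 / 4))\<^sup>2 = pi powr (1 / 4 + 1 / 4)"
      unfolding power2_eq_square by (rule powr_add[symmetric])
    also have "\<dots> = sqrt pi" by (simp add: powr_half_sqrt)
    finally show ?thesis using assms(2) by (simp add: power_divide c_def)
  qed
  have corr: "dilation_correlation f a = of_real (c0 * (1 + a\<^sup>2) powr (- 1 / 2)) \<longleftrightarrow>
      dilation_correlation g a = of_real c * dilation_correlation gaussian a" if "a \<noteq> 0" for a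
  proof -
    have "c0 * (1 + a\<^sup>2) powr (- 1 / 2) = c * (sqrt pi * (1 + a\<^sup>2) powr (- 1 / 2))"
      by (simp add: c_def)
    then show ?thesis
      unfolding dilation_correlation_gaussian dilation_correlation_AE_cong[OF fm gm fg that]
      by (simp only: of_real_mult)
  qed
  have even: "(AE x in lebesgue. f (- x) = f x) \<longleftrightarrow> (AE x in lborel. g (- x) = g x)"
  proof -
    have fg': "AE x in lborel. f (- x) = g (- x)"
      using AE_lborel_scale[OF fg, of "-1"] by simp
    have "(AE x in lborel. f (- x) = f x) \<longleftrightarrow> (AE x in lborel. g (- x) = g x)"
      using fg fg' by (intro eventually_subst) (auto elim: eventually_elim2)
    then show ?thesis by (simp add: AE_completion_iff)
  qed
  \<comment> \<open>The modulus condition compares nonnegative numbers and may be squared, which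
    turns the factor sqrt c0 / pi^(1/4) into c.\<close>
  have sq: "x = K * y \<longleftrightarrow> x\<^sup>2 = K\<^sup>2 * y\<^sup>2" if "x \<ge> 0" "y \<ge> 0" "K \<ge> 0" for x y K :: real
    using that by (metis mult_nonneg_nonneg power2_eq_iff_nonneg power_mult_distrib)
  have "(AE \<tau> in lborel. cmod (M0 f \<tau>) = sqrt c0 / pi powr (1 / 4) * cmod (Gamma (1 / 4 + \<i> / 2 * complex_of_real \<tau>)))
      \<longleftrightarrow> (AE \<tau> in lborel. (cmod (m \<tau>))\<^sup>2 = c * (cmod (k \<tau>))\<^sup>2)"
  proof (rule eventually_subst, use M0m kGamma in eventually_elim)
    case (elim \<tau>)
    show ?case
      unfolding elim(1) elim(2)[symmetric] sqrt_c[symmetric] using assms(2) by (intro sq) auto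
  qed
  then have modulus: "(AE \<tau> in lebesgue. cmod (M0 f \<tau>) = sqrt c0 / pi powr (1 / 4) * cmod (Gamma (1 / 4 + \<i> / 2 * complex_of_real \<tau>)))
      \<longleftrightarrow> (AE \<tau> in lborel. (cmod (m \<tau>))\<^sup>2 = c * (cmod (k \<tau>))\<^sup>2)"
    by (simp only: AE_completion_iff)
  have gaussian_even: "AE x in lborel. gaussian (- x) = gaussian x" by (simp add: gaussian_def)
  show ?thesis
    unfolding even modulus dilation_correlation_proportional_iff[OF m k c gaussian_even, symmetric]
    using corr by blast
qed

end
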